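(* Let $p>2$. Then $f_p\in C^\infty(0,\infty)$.
   Context: For $p>2$, $$X_p=\Big\{f\in W^{1,p}_{\mathrm{loc}}(0,\infty):\ \int_0^\infty\big(|f'|^2+\tfrac{f^2}{r^2}\big)^{p/2}\,r\,dr<\infty\Big\}$$ (real-valued functions; every $f\in X_p$ has a continuous representative on $[0,\infty)$ with $f(0)=0$), and $$I_p(f)=\int_0^\infty\Big\{\Big[(f')^2+\frac{f^2}{r^2}\Big]^{p/2}+\frac12(1-f^2)^2\Big\}\,r\,dr.$$ $f_p$ denotes the unique non-negative minimizer of $I_p$ over $X_p$. *)

theory Defs
  imports "HOL-Analysis.Analysis"
begin

text \<open>
  Elements of Lebesgue and Sobolev spaces on \<open>(0, \<infinity>)\<close> are represented by functions
  \<open>real \<Rightarrow> real\<close>; values on \<open>(-\<infinity>, 0]\<close> are irrelevant, and all notions below except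
  \<open>C_infinity_on\<close> and \<open>test_functions\<close> are invariant under changes on null sets.
\<close>

text \<open>
  Meant for open \<open>S\<close>. Differentiability of every iterated derivative makes all of them continuous.
\<close>

definition C_infinity_on :: "real set \<Rightarrow> (real \<Rightarrow> real) \<Rightarrow> bool" where
  "C_infinity_on S f \<longleftrightarrow> (\<forall>n. \<forall>x\<in>S. (deriv ^^ n) f field_differentiable at x)"

text \<open>The space \<open>C\<^sub>c\<^sup>\<infinity>(0, \<infinity>)\<close>, each function being extended by zero.\<close>

definition test_functions :: "(real \<Rightarrow> real) set" where
  "test_functions = {\<phi>. C_infinity_on UNIV \<phi> \<and>
     (\<exists>K. compact K \<and> K \<subseteq> {0<..} \<and> (\<forall>x. x \<notin> K \<longrightarrow> \<phi> x = 0))}"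

definition Lp_loc :: "real \<Rightarrow> (real \<Rightarrow> real) set" where
  "Lp_loc p = {f. f \<in> borel_measurable (lebesgue_on {0<..}) \<and>
     (\<forall>K. compact K \<longrightarrow> K \<subseteq> {0<..} \<longrightarrow> set_integrable lebesgue K (\<lambda>r. \<bar>f r\<bar> powr p))}"

definition has_weak_derivative :: "(real \<Rightarrow> real) \<Rightarrow> (real \<Rightarrow> real) \<Rightarrow> bool" where
  "has_weak_derivative f g \<longleftrightarrow> f \<in> Lp_loc 1 \<and> g \<in> Lp_loc 1 \<and>
     (\<forall>\<phi>\<in>test_functions.
        (LINT r:{0<..}|lebesgue. f r * deriv \<phi> r) = - (LINT r:{0<..}|lebesgue. g r * \<phi> r))"

text \<open>
  A weak derivative is unique up to null sets, so the integrals below do not depend on the choice.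
\<close>

definition weak_deriv :: "(real \<Rightarrow> real) \<Rightarrow> real \<Rightarrow> real" where
  "weak_deriv f = (SOME g. has_weak_derivative f g)"

definition W1p_loc :: "real \<Rightarrow> (real \<Rightarrow> real) set" where
  "W1p_loc p = {f \<in> Lp_loc p. \<exists>g \<in> Lp_loc p. has_weak_derivative f g}"

definition X_space :: "real \<Rightarrow> (real \<Rightarrow> real) set" where
  "X_space p = {f \<in> W1p_loc p.
     (\<integral>\<^sup>+r\<in>{0<..}. ennreal ((\<bar>weak_deriv f r\<bar>\<^sup>2 + (f r)\<^sup>2 / r\<^sup>2) powr (p / 2) * r) \<partial>lebesgue) < \<infinity>}"

definition energy :: "real \<Rightarrow> (real \<Rightarrow> real) \<Rightarrow> ennreal" where
  "energy p f =
     (\<integral>\<^sup>+r\<in>{0<..}. ennreal ((((weak_deriv f r)\<^sup>2 + (f r)\<^sup>2 / r\<^sup>2) powr (p / 2)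
        + 1 / 2 * (1 - (f r)\<^sup>2)\<^sup>2) * r) \<partial>lebesgue)"

text \<open>
  The energy is \<open>\<infinity>\<close> for some elements of \<open>X_space p\<close> (such as \<open>0\<close>), but not for a minimizer
  when \<open>p > 2\<close>, since \<open>r \<mapsto> min r 1\<close> has finite energy.
\<close>

definition nonneg_minimizer :: "real \<Rightarrow> (real \<Rightarrow> real) \<Rightarrow> bool" where
  "nonneg_minimizer p f \<longleftrightarrow> f \<in> X_space p \<and> (AE r in lebesgue. 0 < r \<longrightarrow> 0 \<le> f r) \<and>
     (\<forall>g\<in>X_space p. energy p f \<le> energy p g)"

end

theory Submission
  imports Defs
begin

text \<open>
  Write \<open>F\<close> for the continuous representative of \<open>f\<close>. Minimality gives the weak Euler-Lagrange equation
  \<open>(r w F')' = w F / r - 2 r (1 - F\<^sup>2) F\<close> with \<open>w = p (F'\<^sup>2 + F\<^sup>2 / r\<^sup>2) powr (p / 2 - 1)\<close>. The flux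
  \<open>s \<mapsto> p (s\<^sup>2 + c) powr (p / 2 - 1) s\<close> is a homeomorphism of the line depending continuously on \<open>c \<ge> 0\<close>,
  so \<open>F'\<close> is continuous and the equation holds classically. At a zero of \<open>F \<ge> 0\<close> also \<open>F' = 0\<close>, hence \<open>w\<close>
  is small nearby and the term \<open>- 2 r F\<close> forces \<open>F = 0\<close> in a neighbourhood; as \<open>F = 0\<close> has infinite
  energy, \<open>F > 0\<close> on \<open>(0, \<infinity>)\<close>. There the equation is nondegenerate, \<open>F''\<close> is a smooth function of
  \<open>r\<close>, \<open>F\<close>, \<open>F'\<close>, and bootstrapping applies.
\<close>

section \<open>Iterated differentiability and test functions\<close>

text \<open>The obstacle is degeneracy: \<open>w\<close> vanishes wherever \<open>F\<close> and
  \<open>F'\<close> vanish together, and there the equation yields no second derivative. Positivity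
  therefore has to be extracted while \<open>F\<close> is known to be C^1 and its flux
  differentiable; \<open>F'\<close> itself is differentiated afterwards, by implicit differentiation
  of the flux, whose slope is positive once \<open>F\<close> is. The energy involves an arbitrary
  choice of weak derivative, so the argument is moved to pairs \<open>(F, g)\<close> with
  \<open>F\<close> an indefinite integral of \<open>g\<close>; uniqueness of weak derivatives
  licenses this. A variation by a test function changes the density on a compact interval, where
  local integrability of the \<open>p\<close>-th power of \<open>g\<close> dominates the difference
  quotients, and finiteness of the total energy allows energies to be subtracted. The hypothesis
  \<open>p > 2\<close> acts three times: the density is differentiable even where its base vanishes
  (\<open>p / 2 > 1\<close>), \<open>w\<close> is continuous with value 0 there
  (\<open>p / 2 - 1 > 0\<close>), and \<open>r powr (1 - p)\<close> is integrable at
  infinity.\<close>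

primrec ndiff :: "nat \<Rightarrow> real set \<Rightarrow> (real \<Rightarrow> real) \<Rightarrow> bool" where
  "ndiff 0 S u \<longleftrightarrow> True"
| "ndiff (Suc k) S u \<longleftrightarrow> (\<exists>u'. (\<forall>x\<in>S. (u has_real_derivative u' x) (at x)) \<and> ndiff k S u')"

lemma ndiff_SucI:
  "(\<And>x. x \<in> S \<Longrightarrow> (u has_real_derivative u' x) (at x)) \<Longrightarrow> ndiff k S u' \<Longrightarrow> ndiff (Suc k) S u"
  by auto

lemma ndiff_Suc_imp: "ndiff (Suc k) S u \<Longrightarrow> ndiff k S u"
proof (induction k arbitrary: u)
  case (Suc k)
  then show ?case by (metis ndiff.simps(2))
qed simp

lemma ndiff_cong:
  assumes "open S" "\<And>x. x \<in> S \<Longrightarrow> u x = v x" "ndiff k S u"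
  shows "ndiff k S v"
proof (cases k)
  case (Suc j)
  then obtain u' where u': "\<And>x. x \<in> S \<Longrightarrow> (u has_real_derivative u' x) (at x)" "ndiff j S u'"
    using assms by auto
  have "(v has_real_derivative u' x) (at x)" if "x \<in> S" for x
    using has_field_derivative_transform_within_open[OF u'(1) assms(1)] assms(2) that by blast
  with u'(2) Suc show ?thesis by auto
qed simp

lemma ndiff_const [intro]: "ndiff k S (\<lambda>x. c)"
  by (induction k arbitrary: c) (auto intro!: exI[of _ "\<lambda>x. 0"])

lemma ndiff_id [intro]: "ndiff k S (\<lambda>x. x)"
  by (cases k) (auto intro!: exI[of _ "\<lambda>x. 1"])

lemma ndiff_add [intro]: "ndiff k S u \<Longrightarrow> ndiff k S v \<Longrightarrow> ndiff k S (\<lambda>x. u x + v x)"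
proof (induction k arbitrary: u v)
  case (Suc k)
  from Suc.prems obtain u' v' where
    d: "\<And>x. x \<in> S \<Longrightarrow> (u has_real_derivative u' x) (at x)" "ndiff k S u'"
       "\<And>x. x \<in> S \<Longrightarrow> (v has_real_derivative v' x) (at x)" "ndiff k S v'"
    by auto
  show ?case
    by (rule ndiff_SucI[where u' = "\<lambda>x. u' x + v' x"]) (auto intro!: derivative_eq_intros d Suc.IH)
qed simp

lemma ndiff_mult [intro]: "ndiff k S u \<Longrightarrow> ndiff k S v \<Longrightarrow> ndiff k S (\<lambda>x. u x * v x)"
proof (induction k arbitrary: u v)
  case (Suc k)
  from Suc.prems obtain u' v' where
    d: "\<And>x. x \<in> S \<Longrightarrow> (u has_real_derivative u' x) (at x)" "ndiff k S u'"
       "\<And>x. x \<in> S \<Longrightarrow> (v has_real_derivative v' x) (at x)" "ndiff k S v'"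
    by auto
  have "ndiff k S u" "ndiff k S v"
    using Suc.prems ndiff_Suc_imp by blast+
  then have "ndiff k S (\<lambda>x. u' x * v x + v' x * u x)"
    by (intro ndiff_add Suc.IH d)
  then show ?case
    by (rule ndiff_SucI[rotated]) (auto intro!: derivative_eq_intros d)
qed simp

lemma ndiff_minus [intro]: "ndiff k S u \<Longrightarrow> ndiff k S (\<lambda>x. - u x)"
  using ndiff_mult[OF ndiff_const[of k S "-1"]] by simp

lemma ndiff_diff [intro]: "ndiff k S u \<Longrightarrow> ndiff k S v \<Longrightarrow> ndiff k S (\<lambda>x. u x - v x)"
  using ndiff_add[OF _ ndiff_minus, of k S u v] by simp

lemma ndiff_power [intro]: "ndiff k S u \<Longrightarrow> ndiff k S (\<lambda>x. u x ^ n)"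
  by (induction n) auto

text \<open>The induction covers all exponents at once, because differentiation replaces
  \<open>a\<close> by \<open>a - 1\<close>. Positivity of \<open>u\<close> keeps every such power
  differentiable, negative exponents included.\<close>

lemma ndiff_powr [intro]:
  assumes "ndiff k S u" "\<And>x. x \<in> S \<Longrightarrow> u x > 0"
  shows "ndiff k S (\<lambda>x. u x powr a)"
  using assms(1)
proof (induction k arbitrary: a)
  case (Suc k)
  from Suc.prems obtain u' where
    d: "\<And>x. x \<in> S \<Longrightarrow> (u has_real_derivative u' x) (at x)" "ndiff k S u'"
    by auto
  have "ndiff k S (\<lambda>x. a * u x powr (a - 1) * u' x)"
    using Suc.prems ndiff_Suc_imp by (intro ndiff_mult ndiff_const Suc.IH d) blast
  then show ?case
    by (rule ndiff_SucI[rotated])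
      (use assms(2) in \<open>auto intro!: derivative_eq_intros d simp: powr_diff field_simps\<close>)
qed simp

lemma ndiff_inverse [intro]:
  assumes "open S" "ndiff k S u" "\<And>x. x \<in> S \<Longrightarrow> u x > 0"
  shows "ndiff k S (\<lambda>x. inverse (u x))"
proof (rule ndiff_cong[OF assms(1)])
  show "ndiff k S (\<lambda>x. u x powr (-1))"
    using assms by blast
  show "u x powr (-1) = inverse (u x)" if "x \<in> S" for x
    using assms(3)[OF that] by (simp add: powr_minus)
qed

text \<open>Serves the rescaled and reflected copies of \<open>flat 0\<close> in
  \<open>bump\<close>, whose inner functions are affine.\<close>

lemma ndiff_affine:
  "ndiff k UNIV u \<Longrightarrow> ndiff k UNIV (\<lambda>x. u (c * x + d))"
proof (induction k arbitrary: u)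
  case (Suc k)
  from Suc.prems obtain u' where
    d: "\<And>x. (u has_real_derivative u' x) (at x)" "ndiff k UNIV u'"
    by auto
  have "ndiff k UNIV (\<lambda>x. u' (c * x + d) * c)"
    by (intro ndiff_mult ndiff_const Suc.IH d)
  then show ?case
    by (rule ndiff_SucI[rotated])
      (auto intro!: DERIV_chain2[OF d(1)] derivative_eq_intros)
qed simp

lemma ndiff_deriv:
  assumes "open S" "ndiff (Suc k) S u"
  shows "ndiff k S (deriv u)"
proof -
  from assms obtain u' where
    d: "\<And>x. x \<in> S \<Longrightarrow> (u has_real_derivative u' x) (at x)" "ndiff k S u'"
    by auto
  show ?thesis
    by (rule ndiff_cong[OF assms(1) _ d(2)]) (metis DERIV_imp_deriv d(1))
qed

text \<open>\<open>ndiff\<close> accepts any derivative known on \<open>S\<close>, which suits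
  closure rules, whereas \<open>deriv\<close> is one fixed function. On an open set the two agree,
  since \<open>deriv\<close> at a point depends on a neighbourhood alone.\<close>

lemma C_infinity_on_iff_ndiff:
  assumes "open S"
  shows "C_infinity_on S u \<longleftrightarrow> (\<forall>k. ndiff k S u)"
proof
  assume u: "C_infinity_on S u"
  have "ndiff k S ((deriv ^^ n) u)" for k n
  proof (induction k arbitrary: n)
    case (Suc k)
    show ?case
    proof (rule ndiff_SucI)
      show "ndiff k S ((deriv ^^ Suc n) u)"
        by (rule Suc.IH)
      show "((deriv ^^ n) u has_real_derivative (deriv ^^ Suc n) u x) (at x)" if "x \<in> S" for x
        using u that unfolding C_infinity_on_def funpow.simps o_def
        by (metis DERIV_deriv_iff_field_differentiable)
    qed
  qed simp
  from this[of _ 0] show "\<forall>k. ndiff k S u"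
    by simp
next
  assume u: "\<forall>k. ndiff k S u"
  have nd: "ndiff k S ((deriv ^^ n) u)" for k n
    by (induction n arbitrary: k) (use u assms in \<open>auto intro: ndiff_deriv simp del: ndiff.simps\<close>)
  have "(deriv ^^ n) u field_differentiable at x" if "x \<in> S" for x n
    using nd[of "Suc 0" n] that by (auto simp: field_differentiable_def)
  then show "C_infinity_on S u"
    by (auto simp: C_infinity_on_def)
qed

text \<open>The factor \<open>inverse x ^ j\<close> makes the span of this family closed under differentiation.\<close>

definition flat :: "nat \<Rightarrow> real \<Rightarrow> real" where
  "flat j x = (if 0 < x then inverse x ^ j * exp (- inverse x) else 0)"

text \<open>The substitution \<open>y = 1 / x\<close> turns the right-hand limit into that of
  \<open>y ^ j / exp y\<close> at infinity; on the left the function is 0.\<close>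

lemma flat_tendsto_0: "(flat j \<longlongrightarrow> 0) (at 0)"
proof -
  have "((\<lambda>x. x ^ j / exp x) \<longlongrightarrow> (0::real)) at_top"
    by (rule tendsto_power_div_exp_0)
  then have "((\<lambda>x. inverse x ^ j / exp (inverse x)) \<longlongrightarrow> (0::real)) (at_right 0)"
    by (rule filterlim_compose[OF _ filterlim_inverse_at_top_right])
  then have "(flat j \<longlongrightarrow> 0) (at_right 0)"
    by (rule Lim_transform_eventually)
      (auto simp: flat_def eventually_at_right_field exp_minus field_simps intro!: exI[of _ 1])
  moreover have "(flat j \<longlongrightarrow> 0) (at_left 0)"
    by (rule tendsto_eventually) (auto simp: flat_def eventually_at_left_field intro!: exI[of _ "-1"])
  ultimately show ?thesis
    by (simp add: filterlim_at_split)
qed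

lemma flat_has_derivative:
  "(flat j has_real_derivative flat (j + 2) x - real j * flat (j + 1) x) (at x)"
proof (cases x "0::real" rule: linorder_cases)
  case less
  have "((\<lambda>x. 0) has_real_derivative 0) (at x)"
    by simp
  then have "(flat j has_real_derivative 0) (at x)"
    by (rule has_field_derivative_transform_within_open[of _ _ _ "{..<0}"])
      (use less in \<open>auto simp: flat_def\<close>)
  then show ?thesis
    using less by (simp add: flat_def)
next
  case equal
  \<comment> \<open>At the origin the difference quotient of \<open>flat j\<close> is
    \<open>flat (Suc j)\<close>, so the derivative there is again a limit of the same
    family.\<close>
  have "flat (Suc j) y = flat j y / y" for y
    by (simp add: flat_def divide_inverse)
  then have "((\<lambda>y. flat j y / y) \<longlongrightarrow> 0) (at 0)"
    using flat_tendsto_0[of "Suc j"] by presburger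
  then show ?thesis
    using equal by (simp add: has_field_derivative_iff flat_def)
next
  case greater
  have "((\<lambda>x. inverse x ^ j * exp (- inverse x)) has_real_derivative
      inverse x ^ (j + 2) * exp (- inverse x) - real j * (inverse x ^ (j + 1) * exp (- inverse x))) (at x)"
  proof -
    have P: "((\<lambda>y. y ^ j * exp (- y)) has_real_derivative
        (real j * y ^ (j - 1) - y ^ j) * exp (- y)) (at y)" for y :: real
      by (auto intro!: derivative_eq_intros simp: left_diff_distrib)
    have "x \<noteq> 0" using greater by simp
    then have I: "(inverse has_real_derivative - (inverse x ^ Suc (Suc 0))) (at x)"
      by (rule DERIV_inverse)
    have eq: "(real j * inverse x ^ (j - 1) - inverse x ^ j) * exp (- inverse x)
          * - (inverse x ^ Suc (Suc 0)) = inverse x ^ (j + 2) * exp (- inverse x) - real j * (inverse x ^ (j + 1) * exp (- inverse x))"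
      by (cases j) (simp_all add: left_diff_distrib right_diff_distrib del: power_inverse)
    show ?thesis
      using DERIV_chain2[OF P I] unfolding eq .
  qed
  then have "(flat j has_real_derivative
      inverse x ^ (j + 2) * exp (- inverse x) - real j * (inverse x ^ (j + 1) * exp (- inverse x))) (at x)"
    by (rule has_field_derivative_transform_within_open[of _ _ _ "{0<..}"])
      (use greater in \<open>simp_all add: flat_def\<close>)
  then show ?thesis
    using greater by (simp only: flat_def if_True)
qed

lemma ndiff_flat: "ndiff k UNIV (flat j)"
proof (induction k arbitrary: j)
  case (Suc k)
  have "ndiff k UNIV (\<lambda>x. flat (j + 2) x - real j * flat (j + 1) x)"
    by (intro ndiff_diff ndiff_mult ndiff_const Suc.IH)
  then show ?case
    by (rule ndiff_SucI[rotated]) (rule flat_has_derivative)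
qed simp

text \<open>A profile rising at \<open>a\<close> times one falling at \<open>b\<close>;
  \<open>n\<close> controls the steepness. The arguments are expanded into the form
  \<open>c * x + d\<close> to match \<open>ndiff_affine\<close>, and \<open>bump_eq\<close> restores
  the readable form.\<close>

definition bump :: "nat \<Rightarrow> real \<Rightarrow> real \<Rightarrow> real \<Rightarrow> real" where
  "bump n a b x = flat 0 (real n * x + - real n * a) * flat 0 (- real n * x + real n * b)"

lemma bump_eq: "bump n a b x = flat 0 (real n * (x - a)) * flat 0 (real n * (b - x))"
  by (simp add: bump_def algebra_simps)

lemma bump_bounds: "0 \<le> bump n a b x" "bump n a b x \<le> 1"
  by (auto simp: bump_def flat_def intro!: mult_le_one)

lemma bump_eq_0: "x \<notin> {a..b} \<Longrightarrow> bump n a b x = 0"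
  by (auto simp: bump_eq flat_def zero_less_mult_iff)

lemma bump_pos:
  assumes "n > 0" "a < x" "x < b" shows "bump n a b x > 0"
  using assms by (auto simp: bump_eq flat_def)

text \<open>For \<open>c > 0\<close> the values \<open>flat 0 (n * c) = exp (- 1 / (n * c))\<close>
  tend to 1, while for \<open>c \<le> 0\<close> they are 0 at every scale.\<close>

lemma bump_LIMSEQ:
  "(\<lambda>n. bump (Suc n) a b x) \<longlonglongrightarrow> indicator {a<..<b} x"
proof -
  have *: "(\<lambda>n. flat 0 (real (Suc n) * c)) \<longlonglongrightarrow> (if c > 0 then 1 else 0)" for c
  proof (cases "c > 0")
    case True
    have "(\<lambda>n. exp (- (inverse (real (Suc n)) * inverse c))) \<longlonglongrightarrow> exp (- (0 * inverse c))"
      by (intro tendsto_intros LIMSEQ_inverse_real_of_nat)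
    with True show ?thesis
      by (simp add: flat_def del: of_nat_Suc)
  next
    case False
    then have "\<not> 0 < real (Suc n) * c" for n
      by (simp add: zero_less_mult_iff)
    with False show ?thesis
      by (simp add: flat_def)
  qed
  have "(\<lambda>n. flat 0 (real (Suc n) * (x - a)) * flat 0 (real (Suc n) * (b - x)))
      \<longlonglongrightarrow> (if x - a > 0 then 1 else 0) * (if b - x > 0 then 1 else 0)"
    by (intro tendsto_mult *)
  then show ?thesis
    by (simp add: bump_eq indicator_def split: if_splits)
qed

lemma bump_test_function:
  assumes "0 < a" shows "bump n a b \<in> test_functions"
proof -
  have "C_infinity_on UNIV (bump n a b)"
    unfolding C_infinity_on_iff_ndiff[OF open_UNIV] bump_def
    by (intro allI ndiff_mult ndiff_affine ndiff_flat)
  moreover have "compact {a..b}" "{a..b} \<subseteq> {0<..}"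
    using assms by auto
  ultimately show ?thesis
    unfolding test_functions_def using bump_eq_0 by blast
qed

lemma test_function_DERIV:
  "\<phi> \<in> test_functions \<Longrightarrow> (\<phi> has_real_derivative deriv \<phi> x) (at x)"
  unfolding test_functions_def C_infinity_on_def
  by (clarsimp simp: DERIV_deriv_iff_field_differentiable) (metis UNIV_I funpow_0)

lemma test_function_continuous: "\<phi> \<in> test_functions \<Longrightarrow> continuous_on S \<phi>"
  using DERIV_isCont[OF test_function_DERIV] by (blast intro: continuous_at_imp_continuous_on)

lemma test_function_continuous_deriv:
  assumes "\<phi> \<in> test_functions" shows "continuous_on S (deriv \<phi>)"
proof (intro continuous_at_imp_continuous_on ballI)
  fix x
  have "(deriv ^^ 1) \<phi> field_differentiable at x"
    using assms unfolding test_functions_def C_infinity_on_def by blast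
  then show "isCont (deriv \<phi>) x"
    by (simp add: field_differentiable_imp_continuous_at)
qed

lemma test_function_support:
  assumes "\<phi> \<in> test_functions"
  obtains \<alpha> \<beta> where "0 < \<alpha>" "\<alpha> < \<beta>" "\<And>x. x \<notin> {\<alpha><..<\<beta>} \<Longrightarrow> \<phi> x = 0"
    "\<And>x. x \<notin> {\<alpha><..<\<beta>} \<Longrightarrow> deriv \<phi> x = 0"
proof -
  from assms obtain K where K: "compact K" "K \<subseteq> {0<..}" "\<And>x. x \<notin> K \<Longrightarrow> \<phi> x = 0"
    by (auto simp: test_functions_def)
  obtain \<alpha> \<beta> where \<alpha>\<beta>: "0 < \<alpha>" "\<alpha> < \<beta>" "K \<subseteq> {\<alpha><..<\<beta>}"
  proof (cases "K = {}")
    case True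
    then show ?thesis using that[of 1 2] by auto
  next
    case False
    then obtain s t where st: "s \<in> K" "t \<in> K" "\<And>x. x \<in> K \<Longrightarrow> s \<le> x" "\<And>x. x \<in> K \<Longrightarrow> x \<le> t"
      using compact_attains_inf[OF K(1)] compact_attains_sup[OF K(1)] by metis
    then have "0 < s" "s \<le> t"
      using K(2) by auto
    with st show ?thesis
      \<comment> \<open>Widening to \<open>s / 2\<close> and \<open>t + 1\<close> puts the support
        inside an open interval that stays away from 0, so that \<open>\<phi>\<close> and its
        derivative vanish at both endpoints.\<close>
      using that[of "s / 2" "t + 1"] by fastforce
  qed
  have "deriv \<phi> x = 0" if "x \<notin> {\<alpha><..<\<beta>}" for x
  proof -
    have "((\<lambda>x. 0) has_real_derivative 0) (at x)"
      by simp
    then have "(\<phi> has_real_derivative 0) (at x)"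
      by (rule has_field_derivative_transform_within_open[of _ _ _ "- K"])
        (use K that \<alpha>\<beta> in \<open>auto intro: compact_imp_closed simp: open_Compl\<close>)
    then show ?thesis
      by (rule DERIV_imp_deriv)
  qed
  with \<alpha>\<beta> K show ?thesis
    by (intro that[of \<alpha> \<beta>]) blast+
qed

section \<open>Weak derivatives on the half-line\<close>

text \<open>Local integrability on the open half-line, phrased with compact intervals so that the
  rules of the gauge integral apply; nothing is required near 0 or at infinity.\<close>

definition loc_int :: "(real \<Rightarrow> real) \<Rightarrow> bool" where
  "loc_int u \<longleftrightarrow> (\<forall>a b. 0 < a \<longrightarrow> u absolutely_integrable_on {a..b})"

lemma loc_intD: "loc_int u \<Longrightarrow> 0 < a \<Longrightarrow> u absolutely_integrable_on {a..b}"
  by (simp add: loc_int_def)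

lemma loc_int_integrable: "loc_int u \<Longrightarrow> 0 < a \<Longrightarrow> u integrable_on {a..b}"
  using loc_intD set_lebesgue_integral_eq_integral(1) by blast

lemma loc_int_add: "loc_int u \<Longrightarrow> loc_int v \<Longrightarrow> loc_int (\<lambda>x. u x + v x)"
  by (auto simp: loc_int_def)

lemma loc_int_cmult: "loc_int u \<Longrightarrow> loc_int (\<lambda>x. c * u x)" for c :: real
  by (auto simp: loc_int_def)

lemma loc_int_diff: "loc_int u \<Longrightarrow> loc_int v \<Longrightarrow> loc_int (\<lambda>x. u x - v x)"
  by (auto simp: loc_int_def)

lemma loc_int_continuous: "continuous_on {0<..} u \<Longrightarrow> loc_int u"
  unfolding loc_int_def
  by (intro allI impI absolutely_integrable_continuous_real) (auto elim: continuous_on_subset)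

lemma loc_int_mult_continuous:
  assumes "continuous_on {0<..} u" "loc_int v"
  shows "loc_int (\<lambda>x. u x * v x)"
  unfolding loc_int_def
proof (intro allI impI)
  fix a b :: real assume "0 < a"
  then have c: "continuous_on {a..b} u"
    using assms(1) by (auto elim: continuous_on_subset)
  then have "u \<in> borel_measurable (lebesgue_on {a..b})"
    by (intro continuous_imp_measurable_on_sets_lebesgue) auto
  moreover have "bounded (u ` {a..b})"
    using c by (intro compact_imp_bounded compact_continuous_image) auto
  ultimately show "(\<lambda>x. u x * v x) absolutely_integrable_on {a..b}"
    using loc_intD[OF assms(2) \<open>0 < a\<close>]
    by (intro absolutely_integrable_bounded_measurable_product_real) auto
qed

text \<open>The intervals \<open>?K n\<close> exhaust the half-line, and \<open>u\<close> is the
  pointwise limit of its measurable truncations to them.\<close>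

lemma loc_int_measurable:
  assumes "loc_int u"
  shows "u \<in> borel_measurable (lebesgue_on {0<..})"
proof -
  let ?K = "\<lambda>n. {inverse (real (Suc n))..real (Suc n)}"
  have "(\<lambda>x. if x \<in> ?K n then u x else 0) \<in> borel_measurable lebesgue" for n
    using assms by (intro borel_measurable_if_I absolutely_integrable_imp_borel_measurable)
      (auto simp: loc_int_def)
  moreover have "(\<lambda>n. if x \<in> ?K n then u x else 0) \<longlonglongrightarrow> (if x \<in> {0<..} then u x else 0)" for x
  proof (cases "0 < x")
    case True
    obtain n :: nat where n: "inverse (real (Suc n)) < x"
      using reals_Archimedean[OF True] by blast
    obtain k :: nat where k: "x < real k"
      using reals_Archimedean2 by blast
    have "x \<in> ?K m" if "m \<ge> max n k" for m
    proof -
      have "inverse (real (Suc m)) \<le> inverse (real (Suc n))"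
        using that by (intro le_imp_inverse_le) auto
      moreover have "real k \<le> real (Suc m)"
        using that by simp
      ultimately show ?thesis
        using n k unfolding atLeastAtMost_iff by linarith
    qed
    then have "\<forall>\<^sub>F m in sequentially. (if x \<in> ?K m then u x else 0) = u x"
      unfolding eventually_sequentially by (intro exI[of _ "max n k"]) simp
    then show ?thesis
      using True by (simp add: tendsto_eventually)
  next
    case False
    have "x \<notin> ?K n" for n
    proof -
      have "0 < inverse (real (Suc n))" by simp
      with False show ?thesis by (metis atLeastAtMost_iff less_le_trans)
    qed
    with False show ?thesis
      by simp
  qed
  ultimately have "(\<lambda>x. if x \<in> {0<..} then u x else 0) \<in> borel_measurable lebesgue"
    by (rule borel_measurable_LIMSEQ_real[rotated])
  then show ?thesis
    by (rule borel_measurable_if_D)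
qed

lemma continuous_on_Icc_abs_bound:
  fixes h :: "real \<Rightarrow> real"
  assumes "continuous_on {a..b} h"
  obtains C where "1 \<le> C" "\<And>x. x \<in> {a..b} \<Longrightarrow> \<bar>h x\<bar> \<le> C"
proof -
  have "compact (h ` {a..b})"
    using assms by (rule compact_continuous_image) simp
  then obtain C where "\<forall>y\<in>h ` {a..b}. norm y \<le> C"
    using compact_imp_bounded bounded_iff by blast
  then show ?thesis
    by (intro that[of "max 1 C"]) (auto simp: le_max_iff_disj)
qed

lemma compact_pos_subset_Icc:
  assumes "compact K" "K \<subseteq> {0<..}"
  obtains a b :: real where "0 < a" "a \<le> b" "K \<subseteq> {a..b}"
proof (cases "K = {}")
  case True
  then show ?thesis using that[of 1 1] by auto
next
  case False
  then obtain s t where "s \<in> K" "t \<in> K" "\<And>x. x \<in> K \<Longrightarrow> s \<le> x" "\<And>x. x \<in> K \<Longrightarrow> x \<le> t"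
    using compact_attains_inf[OF assms(1)] compact_attains_sup[OF assms(1)] by metis
  with assms(2) show ?thesis
    by (intro that[of s t]) auto
qed

text \<open>Every compact subset of the open half-line lies in some \<open>{a..b}\<close> with
  \<open>0 < a\<close>, so intervals can replace general compact sets.\<close>

lemma Lp_loc_iff:
  "u \<in> Lp_loc p \<longleftrightarrow> u \<in> borel_measurable (lebesgue_on {0<..}) \<and> loc_int (\<lambda>r. \<bar>u r\<bar> powr p)"
proof -
  have "(\<forall>K. compact K \<longrightarrow> K \<subseteq> {0<..} \<longrightarrow> (\<lambda>r. \<bar>u r\<bar> powr p) absolutely_integrable_on K)
     \<longleftrightarrow> loc_int (\<lambda>r. \<bar>u r\<bar> powr p)" (is "?l \<longleftrightarrow> _")
  proof
    assume ?l
    moreover have "compact {a..b}" "{a..b} \<subseteq> {0<..}" if "0 < a" for a b :: real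
      using that by auto
    ultimately show "loc_int (\<lambda>r. \<bar>u r\<bar> powr p)"
      unfolding loc_int_def by blast
  next
    assume r: "loc_int (\<lambda>r. \<bar>u r\<bar> powr p)"
    show ?l
    proof (intro allI impI)
      fix K :: "real set" assume K: "compact K" "K \<subseteq> {0<..}"
      then obtain a b where "0 < a" "K \<subseteq> {a..b}"
        using compact_pos_subset_Icc by metis
      with r K(1) show "(\<lambda>r. \<bar>u r\<bar> powr p) absolutely_integrable_on K"
        by (intro set_integrable_subset[OF loc_intD]) (auto intro: lmeasurable_compact fmeasurableD)
    qed
  qed
  then show ?thesis
    by (simp add: Lp_loc_def)
qed

lemma loc_int_bound:
  assumes "loc_int v" "u \<in> borel_measurable (lebesgue_on {0<..})"
    and "\<And>x. 0 < x \<Longrightarrow> \<bar>u x\<bar> \<le> v x"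
  shows "loc_int u"
  unfolding loc_int_def
proof (intro allI impI)
  fix a b :: real assume a: "0 < a"
  show "u absolutely_integrable_on {a..b}"
  proof (rule measurable_bounded_by_integrable_imp_absolutely_integrable)
    show "u \<in> borel_measurable (lebesgue_on {a..b})"
      using assms(2) by (rule measurable_restrict_mono) (use a in auto)
    show "v integrable_on {a..b}"
      using assms(1) a by (rule loc_int_integrable)
  qed (use a assms(3) in auto)
qed

lemma Lp_loc_1_iff: "u \<in> Lp_loc 1 \<longleftrightarrow> loc_int u"
proof
  assume "u \<in> Lp_loc 1"
  then show "loc_int u"
    by (auto simp: Lp_loc_iff intro: loc_int_bound)
next
  assume "loc_int u"
  moreover from this have "loc_int (\<lambda>r. \<bar>u r\<bar>)"
    unfolding loc_int_def by (blast intro: set_integrable_abs)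
  ultimately show "u \<in> Lp_loc 1"
    by (auto simp: Lp_loc_iff intro: loc_int_measurable)
qed

section \<open>The fundamental lemma of the calculus of variations\<close>

lemma set_integral_support:
  fixes w :: "real \<Rightarrow> real"
  assumes "0 < a" "\<And>x. x \<notin> {a..b} \<Longrightarrow> w x = 0" "w absolutely_integrable_on {a..b}"
  shows "(LINT r:{0<..}|lebesgue. w r) = integral {a..b} w"
proof -
  have "(LINT r:{0<..}|lebesgue. w r) = (LINT r:{a..b}|lebesgue. w r)"
    unfolding set_lebesgue_integral_def
    by (rule Bochner_Integration.integral_cong) (use assms(1,2) in \<open>auto simp: indicator_def\<close>)
  then show ?thesis
    using set_lebesgue_integral_eq_integral(2)[OF assms(3)] by simp
qed

text \<open>Lebesgue differentiation: at almost every point the averages over short intervals to the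
  right converge to the value, and here all these averages are 0.\<close>

lemma AE_eq_0_if_integrals_0:
  assumes u: "loc_int u" and zero: "\<And>a b. 0 < a \<Longrightarrow> a < b \<Longrightarrow> integral {a..b} u = 0"
  shows "AE r in lebesgue. 0 < r \<longrightarrow> u r = 0"
proof -
  have "AE r in lebesgue. d < r \<longrightarrow> u r = 0" if "0 < d" for d
  proof -
    \<comment> \<open>Differentiation requires integrability on every box, also on boxes that reach
      0 or below. Cutting off below \<open>d\<close> ensures it, and the countably many values
      \<open>d = 1 / (n + 1)\<close> exhaust the half-line.\<close>
    define v where "v x = (if d \<le> x then u x else 0)" for x
    have "v integrable_on cbox a b" for a b
    proof -
      have "u integrable_on {max a d..b}"
        using u that by (intro loc_int_integrable) auto
      then have "(\<lambda>x. if x \<in> {max a d..b} then u x else 0) integrable_on {a..b}"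
        by (subst integrable_restrict_Int) (simp add: Int_absorb2)
      then have "v integrable_on {a..b}"
        by (rule integrable_eq) (auto simp: v_def)
      then show ?thesis
        by simp
    qed
    then obtain N where N: "negligible N"
       "\<And>x e. \<lbrakk>x \<notin> N; 0 < e\<rbrakk> \<Longrightarrow>
               \<exists>\<delta>>0. \<forall>h. 0 < h \<and> h < \<delta> \<longrightarrow>
                         norm (integral (cbox x (x + h *\<^sub>R One)) v /\<^sub>R h ^ DIM(real) - v x) < e"
      using integrable_ccontinuous_explicit[of v] by blast
    have "u x = 0" if x: "x \<notin> N" "d < x" for x
    proof (rule ccontr)
      assume "u x \<noteq> 0"
      then obtain \<delta> where "\<delta> > 0" and *: "\<And>h. 0 < h \<Longrightarrow> h < \<delta> \<Longrightarrow>
          norm (integral (cbox x (x + h *\<^sub>R One)) v /\<^sub>R h ^ DIM(real) - v x) < \<bar>u x\<bar>"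
        using N(2)[OF x(1), of "\<bar>u x\<bar>"] by auto
      have "integral {x..x + \<delta> / 2} v = integral {x..x + \<delta> / 2} u"
        by (rule integral_cong) (use x in \<open>auto simp: v_def\<close>)
      also have "\<dots> = 0"
        using zero[of x "x + \<delta> / 2"] x \<open>0 < d\<close> \<open>\<delta> > 0\<close> by simp
      finally show False
        using *[of "\<delta> / 2"] \<open>\<delta> > 0\<close> x by (simp add: v_def)
    qed
    then show ?thesis
      using N(1) unfolding negligible_iff_null_sets
      by (intro AE_I'[of N]) auto
  qed
  then have "AE r in lebesgue. \<forall>n. inverse (real (Suc n)) < r \<longrightarrow> u r = 0"
    by (subst AE_all_countable) auto
  then show ?thesis
    by eventually_elim (use reals_Archimedean in blast)
qed

text \<open>Bumps with values in \<open>[0, 1]\<close> converge to the indicator of an interval, so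
  dominated convergence with majorant \<open>\<bar>u\<bar>\<close> reduces the claim to vanishing
  integrals over intervals.\<close>

lemma fundamental_lemma_calculus_of_variations:
  assumes u: "loc_int u" and zero: "\<And>\<phi>. \<phi> \<in> test_functions \<Longrightarrow> (LINT r:{0<..}|lebesgue. u r * \<phi> r) = 0"
  shows "AE r in lebesgue. 0 < r \<longrightarrow> u r = 0"
proof (rule AE_eq_0_if_integrals_0[OF u])
  fix a b :: real assume ab: "0 < a" "a < b"
  let ?f = "\<lambda>n r. u r * bump (Suc n) a b r"
  have int: "?f n absolutely_integrable_on {a..b}" for n
  proof -
    have "continuous_on {0<..} (bump (Suc n) a b)"
      using bump_test_function[OF ab(1)] by (rule test_function_continuous)
    then have "loc_int (\<lambda>r. bump (Suc n) a b r * u r)"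
      using u by (rule loc_int_mult_continuous)
    then show ?thesis
      using ab by (simp add: loc_int_def mult.commute)
  qed
  have "integral {a..b} (?f n) = 0" for n
    using zero[OF bump_test_function[OF ab(1)], of "Suc n" b] bump_eq_0[of _ a b "Suc n"]
    by (subst set_integral_support[symmetric, OF ab(1) _ int]) auto
  moreover have "(\<lambda>n. integral {a..b} (?f n)) \<longlonglongrightarrow> integral {a..b} (\<lambda>r. u r * indicator {a<..<b} r)"
  proof (rule dominated_convergence(2))
    show "?f n integrable_on {a..b}" for n
      using int set_lebesgue_integral_eq_integral(1) by blast
    show "(\<lambda>r. \<bar>u r\<bar>) integrable_on {a..b}"
      using loc_intD[OF u ab(1)] by (simp add: absolutely_integrable_on_def)
    show "norm (?f n x) \<le> \<bar>u x\<bar>" for n x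
      using bump_bounds[of "Suc n" a b x] by (simp add: abs_mult mult_left_le)
    show "(\<lambda>n. ?f n x) \<longlonglongrightarrow> u x * indicator {a<..<b} x" for x
      by (intro tendsto_intros bump_LIMSEQ)
  qed
  ultimately have "integral {a..b} (\<lambda>r. u r * indicator {a<..<b} r) = 0"
    by (simp add: LIMSEQ_const_iff)
  also have "integral {a..b} (\<lambda>r. u r * indicator {a<..<b} r) = integral {a..b} u"
    by (rule integral_spike[of "{a, b}"]) (auto simp: indicator_def)
  finally show "integral {a..b} u = 0" .
qed

section \<open>Locally absolutely continuous functions as indefinite integrals\<close>

definition primitive :: "(real \<Rightarrow> real) \<Rightarrow> (real \<Rightarrow> real) \<Rightarrow> bool" where
  "primitive F g \<longleftrightarrow> loc_int g \<and> (\<forall>a b. 0 < a \<longrightarrow> a \<le> b \<longrightarrow> (g has_integral F b - F a) {a..b})"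

lemma primitive_loc_int: "primitive F g \<Longrightarrow> loc_int g"
  by (simp add: primitive_def)

lemma primitive_integral:
  "primitive F g \<Longrightarrow> 0 < a \<Longrightarrow> a \<le> b \<Longrightarrow> integral {a..b} g = F b - F a"
  unfolding primitive_def using integral_unique by blast

lemma primitive_continuous:
  assumes "primitive F g" shows "continuous_on {0<..} F"
proof (rule continuous_at_imp_continuous_on, rule ballI)
  fix x :: real assume "x \<in> {0<..}"
  then have x: "0 < x" by simp
  have "continuous_on {x/2..x+1} (\<lambda>y. F (x/2) + integral {x/2..y} g)"
    using x by (intro continuous_intros indefinite_integral_continuous_1
        loc_int_integrable[OF primitive_loc_int[OF assms]]) auto
  then have "continuous_on {x/2..x+1} F"
    by (rule continuous_on_eq) (use x primitive_integral[OF assms] in auto)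
  then show "isCont F x"
    by (rule continuous_on_interior) (use x in auto)
qed

lemma primitive_exists:
  assumes "loc_int g" obtains F where "primitive F g"
proof -
  \<comment> \<open>The base point lies inside the half-line because \<open>g\<close> need not be
    integrable down to 0. An integral over an interval with reversed endpoints is 0 rather than the
    negative, hence the two cases.\<close>
  define F where "F x = (if 1 \<le> x then integral {1..x} g else - integral {x..1} g)" for x
  have "(g has_integral F b - F a) {a..b}" if ab: "0 < a" "a \<le> b" for a b
  proof -
    have i: "g integrable_on {s..t}" if "0 < s" for s t
      using assms that by (rule loc_int_integrable)
    have "F b - F a = integral {a..b} g"
      using Henstock_Kurzweil_Integration.integral_combine[of a 1 b g]
        Henstock_Kurzweil_Integration.integral_combine[of 1 a b g]
        Henstock_Kurzweil_Integration.integral_combine[of a b 1 g] ab i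
      by (auto simp: F_def)
    with i ab show ?thesis
      by (simp add: integrable_integral)
  qed
  with assms that show ?thesis
    by (auto simp: primitive_def)
qed

lemma primitive_deriv:
  assumes "primitive F g" "continuous_on {0<..} g" "0 < x"
  shows "(F has_real_derivative g x) (at x)"
proof -
  have "continuous_on {x/2..x+1} g"
    using assms by (auto elim: continuous_on_subset)
  then have "((\<lambda>y. integral {x/2..y} g) has_real_derivative g x) (at x within {x/2..x+1})"
    by (rule integral_has_real_derivative) (use assms in auto)
  then have "((\<lambda>y. F (x/2) + integral {x/2..y} g) has_real_derivative g x) (at x within {x/2..x+1})"
    by (auto intro!: derivative_eq_intros)
  then have "(F has_real_derivative g x) (at x within {x/2..x+1})"
    by (rule has_field_derivative_transform_within[of _ _ _ _ 1])
      (use assms primitive_integral[OF assms(1)] in auto)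
  moreover have "at x within {x/2..x+1} = at x"
    using assms by (intro at_within_interior) auto
  ultimately show ?thesis by simp
qed

lemma primitive_cong_AE:
  assumes "primitive F g" "AE r in lebesgue. 0 < r \<longrightarrow> g r = h r"
  shows "primitive F h"
proof -
  have N: "negligible {r. \<not> (0 < r \<longrightarrow> g r = h r)}"
    using assms(2) by (simp add: negligible_iff_null_sets completion.AE_iff_null_sets)
  then have *: "g absolutely_integrable_on {a..b} \<longleftrightarrow> h absolutely_integrable_on {a..b}"
      "(g has_integral i) {a..b} \<longleftrightarrow> (h has_integral i) {a..b}" if "0 < a" for a b i
    using that by (auto intro!: absolutely_integrable_spike_eq has_integral_spike_eq)
  show ?thesis
    using assms(1) unfolding primitive_def loc_int_def by (simp add: *)
qed

text \<open>Difference quotients of \<open>integral {a..x} w - F x * \<phi> x\<close> are dominated by increments of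
  the continuous function \<open>integral {a..x} \<bar>g\<bar>\<close>, so no Fubini argument is needed.\<close>

lemma primitive_mult:
  assumes F: "primitive F g"
    and \<phi>: "\<And>x. 0 < x \<Longrightarrow> (\<phi> has_real_derivative \<phi>' x) (at x)" "continuous_on {0<..} \<phi>'"
  shows "primitive (\<lambda>x. F x * \<phi> x) (\<lambda>x. \<phi> x * g x + \<phi>' x * F x)"
proof -
  let ?w = "\<lambda>x. \<phi> x * g x + \<phi>' x * F x"
  have \<phi>_cont: "continuous_on {0<..} \<phi>"
    by (intro continuous_at_imp_continuous_on) (use \<phi>(1) DERIV_isCont in blast)
  have g: "loc_int g"
    using F by (rule primitive_loc_int)
  have lF: "loc_int F"
    using primitive_continuous[OF F] by (rule loc_int_continuous)
  have w: "loc_int ?w"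
    by (intro loc_int_add loc_int_mult_continuous \<phi>_cont \<phi>(2) g lF)
  have "(?w has_integral F b * \<phi> b - F a * \<phi> a) {a..b}" if ab: "0 < a" "a \<le> b" for a b
  proof -
    obtain C where C: "\<And>x. x \<in> {a..b} \<Longrightarrow> \<bar>\<phi>' x\<bar> \<le> C"
    proof -
      have "continuous_on {a..b} \<phi>'"
        using \<phi>(2) ab by (auto elim: continuous_on_subset)
      then show ?thesis
        using that continuous_on_Icc_abs_bound by blast
    qed
    have "0 \<le> C"
      using C[of a] ab by auto
    define P where "P x = integral {a..x} (\<lambda>s. \<bar>g s\<bar>)" for x
    define H where "H x = integral {a..x} ?w - F x * \<phi> x" for x
    have ig: "(\<lambda>s. \<bar>g s\<bar>) integrable_on {x..y}" if "a \<le> x" for x y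
      using loc_intD[OF g, of x y] that ab by (simp add: absolutely_integrable_on_def)
    have iw: "?w integrable_on {x..y}" "g integrable_on {x..y}" "F integrable_on {x..y}"
      "(\<lambda>s. \<phi> s * g s) integrable_on {x..y}" "(\<lambda>s. \<phi>' s * F s) integrable_on {x..y}"
      "\<phi>' integrable_on {x..y}" if "a \<le> x" for x y
      using that ab
      by (intro loc_int_integrable w g lF loc_int_mult_continuous \<phi>_cont \<phi>(2) loc_int_continuous; simp)+
    have P_diff: "P y - P x = integral {x..y} (\<lambda>s. \<bar>g s\<bar>)" if "a \<le> x" "x \<le> y" for x y
      using Henstock_Kurzweil_Integration.integral_combine[OF that ig[of a]] by (simp add: P_def)
    have F_diff: "\<bar>F s - F x\<bar> \<le> P y - P x" if "a \<le> x" "x \<le> s" "s \<le> y" for x s y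
    proof -
      have "\<bar>F s - F x\<bar> \<le> integral {x..s} (\<lambda>s. \<bar>g s\<bar>)"
        using integral_norm_bound_integral[of g "{x..s}" "\<lambda>s. \<bar>g s\<bar>"] iw(2)[of x s] ig[of x s]
          primitive_integral[OF F, of x s] that ab by simp
      also have "\<dots> \<le> integral {x..y} (\<lambda>s. \<bar>g s\<bar>)"
        using that by (intro integral_subset_le ig) auto
      finally show ?thesis
        using P_diff that by simp
    qed
    \<comment> \<open>The increment of \<open>F x * \<phi> x\<close> is
      \<open>\<phi> y * (F y - F x) + F x * (\<phi> y - \<phi> x)\<close>. Subtracting the integrals
      of these frozen terms leaves only products with a small difference, so the bound is a product
      of two small increments.\<close>
    have H_diff: "\<bar>H y - H x\<bar> \<le> 2 * C * (P y - P x) * (y - x)" if xy: "a \<le> x" "x \<le> y" "y \<le> b" for x y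
    proof -
      have \<phi>_int: "(\<phi>' has_integral \<phi> y - \<phi> x) {x..y}"
        using xy ab \<phi>(1)
        by (intro fundamental_theorem_of_calculus)
          (auto simp flip: has_real_derivative_iff_has_vector_derivative
            intro: has_field_derivative_at_within)
      have g_int: "(g has_integral F y - F x) {x..y}"
        using F xy ab by (simp add: primitive_def)
      have "H y - H x = integral {x..y} ?w - (\<phi> y * (F y - F x) + F x * (\<phi> y - \<phi> x))"
        using Henstock_Kurzweil_Integration.integral_combine[OF xy(1,2) iw(1)[of a]]
        by (simp add: H_def algebra_simps)
      moreover have "((\<lambda>s. ?w s - (\<phi> y * g s + F x * \<phi>' s)) has_integral
          integral {x..y} ?w - (\<phi> y * (F y - F x) + F x * (\<phi> y - \<phi> x))) {x..y}"
        using iw(1) xy by (intro has_integral_diff has_integral_add has_integral_mult_right g_int \<phi>_int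
            integrable_integral) simp
      ultimately have "((\<lambda>s. ?w s - (\<phi> y * g s + F x * \<phi>' s)) has_integral (H y - H x)) {x..y}"
        by metis
      then have 1: "((\<lambda>s. (\<phi> s - \<phi> y) * g s + \<phi>' s * (F s - F x)) has_integral (H y - H x)) {x..y}"
        by (simp add: algebra_simps)
      have 2: "((\<lambda>s. C * (y - x) * \<bar>g s\<bar> + C * (P y - P x)) has_integral
          C * (y - x) * (P y - P x) + (y - x) *\<^sub>R (C * (P y - P x))) {x..y}"
        using integrable_integral[OF ig[of x y]] xy P_diff
          has_integral_const_real[of "C * (P y - P x)" x y]
        by (intro has_integral_add has_integral_mult_right) auto
      have "\<bar>(\<phi> s - \<phi> y) * g s + \<phi>' s * (F s - F x)\<bar> \<le> C * (y - x) * \<bar>g s\<bar> + C * (P y - P x)"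
        if s: "s \<in> {x..y}" for s
      proof -
        have "norm (\<phi> s - \<phi> y) \<le> C * norm (s - y)"
        proof (rule field_differentiable_bound[of "{x..y}" \<phi> \<phi>'])
          show "(\<phi> has_real_derivative \<phi>' z) (at z within {x..y})" if "z \<in> {x..y}" for z
            using \<phi>(1)[of z] that xy ab by (auto intro: has_field_derivative_at_within)
        qed (use C s xy in auto)
        also have "\<dots> \<le> C * (y - x)"
          using s \<open>0 \<le> C\<close> by (intro mult_left_mono) auto
        finally have "\<bar>(\<phi> s - \<phi> y) * g s\<bar> \<le> C * (y - x) * \<bar>g s\<bar>"
          by (simp add: abs_mult mult_right_mono)
        moreover have "\<bar>\<phi>' s * (F s - F x)\<bar> \<le> C * (P y - P x)"
          using C[of s] F_diff[of x s y] s xy by (auto simp: abs_mult intro!: mult_mono)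
        ultimately show ?thesis
          by linarith
      qed
      then have "norm (H y - H x) \<le> C * (y - x) * (P y - P x) + (y - x) *\<^sub>R (C * (P y - P x))"
        using integral_norm_bound_integral[OF has_integral_integrable[OF 1] has_integral_integrable[OF 2]]
        unfolding integral_unique[OF 1] integral_unique[OF 2] by simp
      then show ?thesis
        by (simp add: algebra_simps)
    qed
    have P_cont: "continuous_on {a..b} P"
      unfolding P_def by (intro indefinite_integral_continuous_1 ig) simp
    have "(H has_real_derivative 0) (at x within {a..b})" if x: "x \<in> {a..b}" for x
      unfolding has_field_derivative_iff
    proof (rule Lim_null_comparison)
      show "\<forall>\<^sub>F y in at x within {a..b}. norm ((H y - H x) / (y - x)) \<le> 2 * C * \<bar>P y - P x\<bar>"
        unfolding eventually_at_filter
      proof (intro always_eventually allI impI)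
        fix y assume "y \<noteq> x" "y \<in> {a..b}"
        then have "\<bar>H y - H x\<bar> \<le> 2 * C * \<bar>P y - P x\<bar> * \<bar>y - x\<bar>"
        proof (cases "x \<le> y")
          case True
          then have "P x \<le> P y"
            using F_diff[of x x y] x by simp
          then show ?thesis
            using H_diff[of x y] True x \<open>y \<in> {a..b}\<close> by simp
        next
          case False
          then have "P y \<le> P x"
            using F_diff[of y y x] \<open>y \<in> {a..b}\<close> by simp
          then show ?thesis
            using H_diff[of y x] False x \<open>y \<in> {a..b}\<close> by (simp add: abs_minus_commute)
        qed
        then show "norm ((H y - H x) / (y - x)) \<le> 2 * C * \<bar>P y - P x\<bar>"
          using \<open>y \<noteq> x\<close> by (simp add: field_simps)
      qed
      have "(P \<longlongrightarrow> P x) (at x within {a..b})"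
        using P_cont x by (simp add: continuous_on_def)
      then have "((\<lambda>y. 2 * C * \<bar>P y - P x\<bar>) \<longlongrightarrow> 2 * C * \<bar>P x - P x\<bar>) (at x within {a..b})"
        by (intro tendsto_intros)
      then show "((\<lambda>y. 2 * C * \<bar>P y - P x\<bar>) \<longlongrightarrow> 0) (at x within {a..b})"
        by simp
    qed
    then obtain c where "\<And>x. x \<in> {a..b} \<Longrightarrow> H x = c"
      using has_field_derivative_zero_constant[of "{a..b}" H] by auto
    then have "H b = H a"
      using ab by simp
    then have "integral {a..b} ?w = F b * \<phi> b - F a * \<phi> a"
      by (simp add: H_def)
    then show ?thesis
      using iw(1)[of a b] by (simp add: has_integral_iff)
  qed
  with w show ?thesis
    by (simp add: primitive_def)
qed

lemma primitive_of_deriv: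
  assumes "\<And>x. 0 < x \<Longrightarrow> (\<phi> has_real_derivative \<phi>' x) (at x)" "continuous_on {0<..} \<phi>'"
  shows "primitive \<phi> \<phi>'"
proof -
  have "primitive (\<lambda>x. 1) (\<lambda>x. 0)"
    by (auto simp: primitive_def loc_int_def)
  from primitive_mult[OF this assms] show ?thesis
    by simp
qed

lemma primitive_add:
  assumes F: "primitive F g" and G: "primitive G h"
  shows "primitive (\<lambda>x. F x + G x) (\<lambda>x. g x + h x)"
  unfolding primitive_def
proof (intro conjI allI impI)
  show "loc_int (\<lambda>x. g x + h x)"
    using F G by (intro loc_int_add primitive_loc_int)
  fix a b :: real assume "0 < a" "a \<le> b"
  then have "((\<lambda>x. g x + h x) has_integral (F b - F a) + (G b - G a)) {a..b}"
    using F G by (intro has_integral_add) (simp_all add: primitive_def)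
  then show "((\<lambda>x. g x + h x) has_integral F b + G b - (F a + G a)) {a..b}"
    by (simp add: algebra_simps)
qed

lemma primitive_cmult:
  assumes F: "primitive F g"
  shows "primitive (\<lambda>x. c * F x) (\<lambda>x. c * g x)"
  unfolding primitive_def
proof (intro conjI allI impI)
  show "loc_int (\<lambda>x. c * g x)"
    using F by (intro loc_int_cmult primitive_loc_int)
  fix a b :: real assume "0 < a" "a \<le> b"
  then have "((\<lambda>x. c * g x) has_integral c * (F b - F a)) {a..b}"
    using F by (intro has_integral_mult_right) (simp add: primitive_def)
  then show "((\<lambda>x. c * g x) has_integral c * F b - c * F a) {a..b}"
    by (simp add: algebra_simps)
qed

lemma primitive_const: "primitive F g \<Longrightarrow> primitive (\<lambda>x. F x + c) g"
  by (simp add: primitive_def)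

section \<open>Weak derivatives versus indefinite integrals\<close>

lemma loc_int_mult_test:
  assumes "loc_int u" "\<phi> \<in> test_functions"
  shows "loc_int (\<lambda>r. u r * \<phi> r)" "loc_int (\<lambda>r. u r * deriv \<phi> r)"
proof -
  have "continuous_on {0<..} \<phi>" "continuous_on {0<..} (deriv \<phi>)"
    using assms(2) by (rule test_function_continuous test_function_continuous_deriv)+
  from this[THEN loc_int_mult_continuous, OF assms(1)]
  show "loc_int (\<lambda>r. u r * \<phi> r)" "loc_int (\<lambda>r. u r * deriv \<phi> r)"
    by (simp_all add: mult.commute)
qed

lemma set_integral_test:
  assumes u: "loc_int u" and \<phi>: "\<phi> \<in> test_functions"
    and ab: "0 < a" "\<And>x. x \<notin> {a<..<b} \<Longrightarrow> \<phi> x = 0" "\<And>x. x \<notin> {a<..<b} \<Longrightarrow> deriv \<phi> x = 0"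
  shows "(LINT r:{0<..}|lebesgue. u r * \<phi> r) = integral {a..b} (\<lambda>r. u r * \<phi> r)"
    "(LINT r:{0<..}|lebesgue. u r * deriv \<phi> r) = integral {a..b} (\<lambda>r. u r * deriv \<phi> r)"
  using ab loc_int_mult_test[OF u \<phi>]
  by (auto intro!: set_integral_support loc_intD)

text \<open>Integration by parts: \<open>F x * \<phi> x\<close> is an indefinite integral by
  \<open>primitive_mult\<close>, and it vanishes at both ends of an interval around the
  support.\<close>

lemma primitive_has_weak_derivative:
  assumes "primitive F g"
  shows "has_weak_derivative F g"
  unfolding has_weak_derivative_def
proof (intro conjI ballI)
  have g: "loc_int g" and F: "loc_int F"
    using assms by (auto intro: primitive_loc_int loc_int_continuous primitive_continuous)
  then show "F \<in> Lp_loc 1" "g \<in> Lp_loc 1"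
    by (simp_all add: Lp_loc_1_iff)
  fix \<phi> assume \<phi>: "\<phi> \<in> test_functions"
  from test_function_support[OF this] obtain a b where ab: "0 < a" "a < b"
      "\<And>x. x \<notin> {a<..<b} \<Longrightarrow> \<phi> x = 0" "\<And>x. x \<notin> {a<..<b} \<Longrightarrow> deriv \<phi> x = 0"
    by blast
  have "primitive (\<lambda>x. F x * \<phi> x) (\<lambda>x. \<phi> x * g x + deriv \<phi> x * F x)"
    by (rule primitive_mult[OF assms test_function_DERIV test_function_continuous_deriv]) (use \<phi> in auto)
  from primitive_integral[OF this, of a b] ab
  have "integral {a..b} (\<lambda>x. \<phi> x * g x + deriv \<phi> x * F x) = 0"
    by simp
  then have "integral {a..b} (\<lambda>x. g x * \<phi> x + F x * deriv \<phi> x) = 0"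
    by (simp add: mult.commute)
  then have "integral {a..b} (\<lambda>x. g x * \<phi> x) + integral {a..b} (\<lambda>x. F x * deriv \<phi> x) = 0"
    using ab(1) \<phi>
    by (subst Henstock_Kurzweil_Integration.integral_add[symmetric])
      (auto intro!: loc_int_integrable loc_int_mult_test F g)
  then show "(LINT r:{0<..}|lebesgue. F r * deriv \<phi> r) = - (LINT r:{0<..}|lebesgue. g r * \<phi> r)"
    using set_integral_test[OF F \<phi>, of a b] set_integral_test[OF g \<phi>, of a b] ab by simp
qed

text \<open>Zero mean is what makes the antiderivative vanish to the right of the support as
  well.\<close>

lemma test_function_antiderivative:
  assumes ab: "0 < a" "a < b" and smooth: "\<And>k. ndiff k UNIV \<psi>"
    and supp: "\<And>x. x \<notin> {a<..<b} \<Longrightarrow> \<psi> x = 0" and int: "integral {a..b} \<psi> = 0"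
  obtains \<phi> where "\<phi> \<in> test_functions" "deriv \<phi> = \<psi>"
proof -
  \<comment> \<open>Starting at \<open>a - 1\<close> instead of \<open>a\<close> makes every
    \<open>x \<ge> a\<close> an interior point of \<open>{a - 1..x + 1}\<close>, so the derivative
    is two-sided there.\<close>
  define \<phi> where "\<phi> x = integral {a - 1..x} \<psi>" for x
  obtain \<psi>' where "\<And>x. (\<psi> has_real_derivative \<psi>' x) (at x)"
    using smooth[of 1] by auto
  then have cont: "continuous_on S \<psi>" for S
    using DERIV_isCont continuous_at_imp_continuous_on by blast
  then have i: "\<psi> integrable_on {x..y}" for x y
    by (rule integrable_continuous_real)
  have zero: "integral {x..y} \<psi> = 0" if "y \<le> a \<or> b \<le> x" for x y
    using that supp by (intro integral_eq_0_iff[THEN iffD2] integral_unique has_integral_is_0) auto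
  have l: "\<phi> x = 0" if "x \<le> a" for x
    using zero[of x "a - 1"] that by (simp add: \<phi>_def)
  have r: "\<phi> x = 0" if "b \<le> x" for x
  proof -
    have "\<phi> x = integral {a - 1..a} \<psi> + integral {a..b} \<psi> + integral {b..x} \<psi>"
      unfolding \<phi>_def using that ab i
      by (simp add: Henstock_Kurzweil_Integration.integral_combine)
    with zero int show ?thesis
      by simp
  qed
  have d: "(\<phi> has_real_derivative \<psi> x) (at x)" for x
  proof (cases "x < a")
    case True
    have "((\<lambda>x. 0) has_real_derivative 0) (at x)"
      by simp
    then have "(\<phi> has_real_derivative 0) (at x)"
      by (rule has_field_derivative_transform_within_open[of _ _ _ "{..<a}"]) (use True l in auto)
    with True supp show ?thesis
      by simp
  next
    case False
    then have "(\<phi> has_real_derivative \<psi> x) (at x within {a - 1..x + 1})"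
      unfolding \<phi>_def by (intro integral_has_real_derivative cont) auto
    moreover have "at x within {a - 1..x + 1} = at x"
      using False by (intro at_within_interior) auto
    ultimately show ?thesis
      by simp
  qed
  have "ndiff k UNIV \<phi>" for k
    using d smooth by (cases k) auto
  then have "C_infinity_on UNIV \<phi>"
    by (simp add: C_infinity_on_iff_ndiff)
  moreover have "compact {a..b}" "{a..b} \<subseteq> {0<..}" "\<forall>x. x \<notin> {a..b} \<longrightarrow> \<phi> x = 0"
    using ab l r by auto
  ultimately have "\<phi> \<in> test_functions"
    unfolding test_functions_def by blast
  moreover have "deriv \<phi> = \<psi>"
    using d DERIV_imp_deriv by blast
  ultimately show ?thesis
    using that by blast
qed

text \<open>Every test function \<open>\<psi>\<close> is the derivative of a test function up to a
  multiple of one fixed bump \<open>\<eta>\<close>: subtracting \<open>J * \<eta>\<close> removes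
  its mean. Testing with that antiderivative shows that \<open>u\<close> and the weighted mean
  \<open>c\<close> have the same integral against \<open>\<psi>\<close>, and the fundamental lemma
  applies to \<open>u - c\<close>.\<close>

lemma du_Bois_Reymond:
  assumes u: "loc_int u"
    and zero: "\<And>\<phi>. \<phi> \<in> test_functions \<Longrightarrow> (LINT r:{0<..}|lebesgue. u r * deriv \<phi> r) = 0"
  obtains c where "AE r in lebesgue. 0 < r \<longrightarrow> u r = c"
proof -
  define \<eta> where "\<eta> = bump 1 1 2"
  have \<eta>: "\<eta> \<in> test_functions"
    unfolding \<eta>_def by (rule bump_test_function) simp
  have \<eta>_supp: "\<eta> x = 0" if "x \<notin> {1<..<2}" for x
    using that bump_eq_0[of x 1 2 1] by (auto simp: \<eta>_def bump_eq flat_def)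
  have smooth: "ndiff k UNIV \<psi>" if "\<psi> \<in> test_functions" for k \<psi>
    using that by (auto simp: test_functions_def C_infinity_on_iff_ndiff)
  have cont: "continuous_on S \<psi>" if "\<psi> \<in> test_functions" for S \<psi>
    using that by (rule test_function_continuous)
  have loc: "loc_int \<psi>" if "\<psi> \<in> test_functions" for \<psi>
    by (rule loc_int_continuous[OF cont[OF that]])
  define I where "I = integral {1..2} \<eta>"
  have "I \<noteq> 0"
  proof
    assume "I = 0"
    then have "\<forall>x\<in>{1..2}. \<eta> x = 0"
      unfolding I_def
      by (subst (asm) integral_eq_0_iff) (use cont[OF \<eta>] bump_bounds in \<open>auto simp: \<eta>_def\<close>)
    then have "\<eta> (3/2) = 0"
      by simp
    with bump_pos[of 1 1 "3/2" 2] show False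
      by (simp add: \<eta>_def)
  qed
  have \<eta>_int: "integral {a..b} (\<lambda>r. v r * \<eta> r) = integral {1..2} (\<lambda>r. v r * \<eta> r)"
    if "a \<le> 1" "2 \<le> b" for a b v
  proof -
    have "integral {a..b} (\<lambda>r. v r * \<eta> r)
        = integral {a..b} (\<lambda>r. if r \<in> {1..2} then v r * \<eta> r else 0)"
      using \<eta>_supp by (intro integral_cong) auto
    also have "\<dots> = integral {1..2} (\<lambda>r. v r * \<eta> r)"
      using that by (subst integral_restrict_Int) simp
    finally show ?thesis .
  qed
  define c where "c = integral {1..2} (\<lambda>r. u r * \<eta> r) / I"
  have uc: "loc_int (\<lambda>r. u r - c)"
    by (intro loc_int_diff u loc_int_continuous continuous_intros)
  have "AE r in lebesgue. 0 < r \<longrightarrow> u r - c = 0"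
  proof (rule fundamental_lemma_calculus_of_variations[OF uc])
    fix \<psi> assume \<psi>: "\<psi> \<in> test_functions"
    then obtain a0 b0 where ab0: "0 < a0" "a0 < b0" "\<And>x. x \<notin> {a0<..<b0} \<Longrightarrow> \<psi> x = 0"
      using test_function_support by metis
    \<comment> \<open>One interval has to contain the supports of both \<open>\<psi>\<close> and
      \<open>\<eta>\<close>.\<close>
    define a b where "a = min a0 1" and "b = max b0 2"
    have ab: "0 < a" "a < b" "a \<le> 1" "2 \<le> b"
      using ab0(1,2) by (auto simp: a_def b_def)
    have \<psi>_supp: "\<psi> x = 0" if "x \<notin> {a<..<b}" for x
      by (rule ab0(3)) (use that in \<open>auto simp: a_def b_def\<close>)
    define J where "J = integral {a..b} \<psi> / I"
    let ?w = "\<lambda>x. \<psi> x - J * \<eta> x"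
    have \<eta>i: "integral {a..b} \<eta> = I"
      using \<eta>_int[OF ab(3,4), of "\<lambda>_. 1"] by (simp add: I_def)
    have "integral {a..b} ?w = integral {a..b} \<psi> - J * integral {a..b} \<eta>"
      using loc_int_integrable[OF loc[OF \<psi>] ab(1)] loc_int_integrable[OF loc[OF \<eta>] ab(1)]
      by (subst Henstock_Kurzweil_Integration.integral_diff) (auto intro!: integrable_on_mult_right)
    then have "integral {a..b} ?w = 0"
      using \<open>I \<noteq> 0\<close> by (simp add: \<eta>i J_def)
    moreover have w0: "?w x = 0" if "x \<notin> {a<..<b}" for x
      using that ab(3,4) \<psi>_supp[of x] \<eta>_supp[of x] by auto
    moreover have "ndiff k UNIV ?w" for k
      by (intro ndiff_diff ndiff_mult ndiff_const smooth \<psi> \<eta>)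
    ultimately obtain \<phi> where \<phi>: "\<phi> \<in> test_functions" "deriv \<phi> = ?w"
      using test_function_antiderivative[OF ab(1,2), of ?w] by blast
    have li: "loc_int (\<lambda>r. u r * \<psi> r)" "loc_int (\<lambda>r. u r * \<eta> r)" "loc_int \<psi>"
      using loc_int_mult_test(1)[OF u] \<psi> \<eta> loc by auto
    note ii = li[THEN loc_int_integrable, OF ab(1), of b]
    have "loc_int (\<lambda>r. u r * ?w r)"
      using loc_int_mult_test(2)[OF u \<phi>(1)] \<phi>(2) by simp
    then have "0 = integral {a..b} (\<lambda>r. u r * ?w r)"
      using zero[OF \<phi>(1)] unfolding \<phi>(2)
      by (subst (asm) set_integral_support[of a b]) (use w0 ab(1) in \<open>auto intro: loc_intD\<close>)
    also have "(\<lambda>r. u r * ?w r) = (\<lambda>r. u r * \<psi> r - J * (u r * \<eta> r))"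
      by (auto simp: algebra_simps)
    also have "integral {a..b} \<dots> = integral {a..b} (\<lambda>r. u r * \<psi> r) - J * integral {a..b} (\<lambda>r. u r * \<eta> r)"
      using ii by (subst Henstock_Kurzweil_Integration.integral_diff) (auto intro!: integrable_on_mult_right)
    also have "J * integral {a..b} (\<lambda>r. u r * \<eta> r) = c * integral {a..b} \<psi>"
      using \<eta>_int[OF ab(3,4), of u] by (simp add: J_def c_def)
    also have "integral {a..b} (\<lambda>r. u r * \<psi> r) - \<dots> = integral {a..b} (\<lambda>r. u r * \<psi> r - c * \<psi> r)"
      using ii by (subst Henstock_Kurzweil_Integration.integral_diff) (auto intro!: integrable_on_mult_right)
    also have "(\<lambda>r. u r * \<psi> r - c * \<psi> r) = (\<lambda>r. (u r - c) * \<psi> r)"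
      by (auto simp: algebra_simps)
    finally have "integral {a..b} (\<lambda>r. (u r - c) * \<psi> r) = 0"
      by simp
    moreover have "(LINT r:{0<..}|lebesgue. (u r - c) * \<psi> r) = integral {a..b} (\<lambda>r. (u r - c) * \<psi> r)"
      using ab(1) \<psi>_supp loc_int_mult_test(1)[OF uc \<psi>]
      by (intro set_integral_support) (auto intro!: loc_intD)
    ultimately show "(LINT r:{0<..}|lebesgue. (u r - c) * \<psi> r) = 0"
      by simp
  qed
  then show ?thesis
    using that[of c] by simp
qed

text \<open>\<open>f\<close> and any indefinite integral of \<open>g\<close> have the same weak
  derivative, so they differ by a constant, which is absorbed into the integral.\<close>

theorem weak_derivative_primitive:
  assumes "has_weak_derivative f g"
  obtains F where "primitive F g" "AE r in lebesgue. 0 < r \<longrightarrow> f r = F r"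
proof -
  have f: "loc_int f" and g: "loc_int g"
    using assms by (simp_all add: has_weak_derivative_def Lp_loc_1_iff)
  obtain F where F: "primitive F g"
    using primitive_exists[OF g] .
  have lF: "loc_int F"
    using loc_int_continuous[OF primitive_continuous[OF F]] .
  have "(LINT r:{0<..}|lebesgue. (f r - F r) * deriv \<phi> r) = 0" if \<phi>: "\<phi> \<in> test_functions" for \<phi>
  proof -
    obtain a b where ab: "0 < a" "\<And>x. x \<notin> {a<..<b} \<Longrightarrow> \<phi> x = 0" "\<And>x. x \<notin> {a<..<b} \<Longrightarrow> deriv \<phi> x = 0"
      using test_function_support[OF \<phi>] by metis
    have "(LINT r:{0<..}|lebesgue. f r * deriv \<phi> r) = (LINT r:{0<..}|lebesgue. F r * deriv \<phi> r)"
      using assms primitive_has_weak_derivative[OF F] \<phi> by (simp add: has_weak_derivative_def)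
    moreover have "integral {a..b} (\<lambda>r. (f r - F r) * deriv \<phi> r)
        = integral {a..b} (\<lambda>r. f r * deriv \<phi> r) - integral {a..b} (\<lambda>r. F r * deriv \<phi> r)"
      unfolding left_diff_distrib
      by (intro Henstock_Kurzweil_Integration.integral_diff loc_int_integrable loc_int_mult_test f lF \<phi> ab)
    ultimately show ?thesis
      using set_integral_test(2)[OF f \<phi> ab] set_integral_test(2)[OF lF \<phi> ab]
        set_integral_test(2)[OF loc_int_diff[OF f lF] \<phi> ab] by simp
  qed
  then obtain c where "AE r in lebesgue. 0 < r \<longrightarrow> f r - F r = c"
    using du_Bois_Reymond[OF loc_int_diff[OF f lF]] by blast
  then have "AE r in lebesgue. 0 < r \<longrightarrow> f r = F r + c"
    by eventually_elim auto
  then show ?thesis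
    using that primitive_const[OF F] by blast
qed

text \<open>Ties the arbitrary choice in \<open>weak_deriv\<close> to any known weak derivative:
  both have the same integrals against test functions.\<close>

lemma weak_deriv_AE:
  assumes "has_weak_derivative f g"
  shows "AE r in lebesgue. 0 < r \<longrightarrow> weak_deriv f r = g r"
proof -
  let ?h = "weak_deriv f"
  have h: "has_weak_derivative f ?h"
    unfolding weak_deriv_def using someI[of "has_weak_derivative f", OF assms] .
  have lg: "loc_int g" and lh: "loc_int ?h"
    using assms h by (simp_all add: has_weak_derivative_def Lp_loc_1_iff)
  have "AE r in lebesgue. 0 < r \<longrightarrow> ?h r - g r = 0"
  proof (rule fundamental_lemma_calculus_of_variations[OF loc_int_diff[OF lh lg]])
    fix \<phi> assume \<phi>: "\<phi> \<in> test_functions"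
    obtain a b where ab: "0 < a" "\<And>x. x \<notin> {a<..<b} \<Longrightarrow> \<phi> x = 0" "\<And>x. x \<notin> {a<..<b} \<Longrightarrow> deriv \<phi> x = 0"
      using test_function_support[OF \<phi>] by metis
    have "(LINT r:{0<..}|lebesgue. ?h r * \<phi> r) = (LINT r:{0<..}|lebesgue. g r * \<phi> r)"
      using assms h \<phi> by (simp add: has_weak_derivative_def)
    moreover have "integral {a..b} (\<lambda>r. (?h r - g r) * \<phi> r)
        = integral {a..b} (\<lambda>r. ?h r * \<phi> r) - integral {a..b} (\<lambda>r. g r * \<phi> r)"
      unfolding left_diff_distrib
      by (intro Henstock_Kurzweil_Integration.integral_diff loc_int_integrable loc_int_mult_test lh lg \<phi> ab)
    ultimately show "(LINT r:{0<..}|lebesgue. (?h r - g r) * \<phi> r) = 0"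
      using set_integral_test(1)[OF lh \<phi> ab] set_integral_test(1)[OF lg \<phi> ab]
        set_integral_test(1)[OF loc_int_diff[OF lh lg] \<phi> ab] by simp
  qed
  then show ?thesis
    by eventually_elim auto
qed

section \<open>The weak Euler-Lagrange equation\<close>

text \<open>At a zero of \<open>Q\<close> the difference quotient is that of \<open>Q\<close> times
  \<open>Q s powr (q - 1)\<close>, and the last factor tends to 0 because \<open>q > 1\<close>.
  Elsewhere the ordinary power rule applies.\<close>

lemma has_real_derivative_powr_nonneg:
  fixes Q :: "real \<Rightarrow> real"
  assumes q: "1 < q" and nonneg: "\<And>s. 0 \<le> Q s" and d: "(Q has_real_derivative Q') (at t)"
  shows "((\<lambda>s. Q s powr q) has_real_derivative q * Q t powr (q - 1) * Q') (at t)"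
proof (cases "Q t = 0")
  case True
  have "(Q \<longlongrightarrow> Q t) (at t)"
    using DERIV_isCont[OF d] by (simp add: isCont_def)
  then have "((\<lambda>s. Q s powr (q - 1)) \<longlongrightarrow> Q t powr (q - 1)) (at t)"
    using q nonneg by (intro tendsto_powr') auto
  moreover have "((\<lambda>s. (Q s - Q t) / (s - t)) \<longlongrightarrow> Q') (at t)"
    using d by (simp add: has_field_derivative_iff)
  ultimately have "((\<lambda>s. (Q s - Q t) / (s - t) * Q s powr (q - 1)) \<longlongrightarrow> Q' * Q t powr (q - 1)) (at t)"
    by (intro tendsto_mult)
  moreover have "(\<lambda>s. (Q s - Q t) / (s - t) * Q s powr (q - 1))
      = (\<lambda>s. (Q s powr q - Q t powr q) / (s - t))"
  proof
    fix s
    have "Q s * Q s powr (q - 1) = Q s powr q"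
      using nonneg[of s] by (cases "Q s = 0") (simp_all add: powr_mult_base)
    with True show "(Q s - Q t) / (s - t) * Q s powr (q - 1) = (Q s powr q - Q t powr q) / (s - t)"
      by simp
  qed
  ultimately have "((\<lambda>s. (Q s powr q - Q t powr q) / (s - t)) \<longlongrightarrow> Q' * Q t powr (q - 1)) (at t)"
    by metis
  with True show ?thesis
    unfolding has_field_derivative_iff by simp
next
  case False
  with nonneg[of t] have "0 < Q t"
    by simp
  from DERIV_fun_powr[OF d this, of q] show ?thesis
    by simp
qed

section \<open>The Lagrangian, its directional derivative and growth bounds\<close>

definition energy_density :: "real \<Rightarrow> real \<Rightarrow> real \<Rightarrow> real \<Rightarrow> real" where
  "energy_density p r a b = ((a\<^sup>2 + b\<^sup>2 / r\<^sup>2) powr (p / 2) + 1 / 2 * (1 - b\<^sup>2)\<^sup>2) * r"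

text \<open>The derivative of the Lagrangian at slope \<open>a\<close> and value \<open>b\<close> in
  the direction \<open>(a', b')\<close>.\<close>

definition energy_variation :: "real \<Rightarrow> real \<Rightarrow> real \<Rightarrow> real \<Rightarrow> real \<Rightarrow> real \<Rightarrow> real" where
  "energy_variation p r a b a' b' =
     (p * (a\<^sup>2 + b\<^sup>2 / r\<^sup>2) powr (p / 2 - 1) * (a * a' + b * b' / r\<^sup>2) - 2 * (1 - b\<^sup>2) * b * b') * r"

lemma energy_density_nonneg: "0 < r \<Longrightarrow> 0 \<le> energy_density p r a b"
  by (simp add: energy_density_def)

lemma energy_density_DERIV:
  assumes "2 < p"
  shows "((\<lambda>t. energy_density p r (a + t * a') (b + t * b')) has_real_derivative
    energy_variation p r (a + t * a') (b + t * b') a' b') (at t)"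
proof -
  let ?Q = "\<lambda>t. (a + t * a')\<^sup>2 + (b + t * b')\<^sup>2 / r\<^sup>2"
  have sq: "((\<lambda>t. (c + t * c')\<^sup>2) has_real_derivative 2 * (c + t * c') * c') (at t)" for c c'
    by (auto intro!: derivative_eq_intros)
  have "(?Q has_real_derivative 2 * ((a + t * a') * a' + (b + t * b') * b' / r\<^sup>2)) (at t)"
    by (rule DERIV_cong[OF DERIV_add[OF sq DERIV_cdivide[OF sq]]]) (simp add: algebra_simps)
  then have "((\<lambda>t. ?Q t powr (p / 2)) has_real_derivative
      p / 2 * ?Q t powr (p / 2 - 1) * (2 * ((a + t * a') * a' + (b + t * b') * b' / r\<^sup>2))) (at t)"
    using assms by (intro has_real_derivative_powr_nonneg) auto
  moreover have "((\<lambda>t. 1 / 2 * (1 - (b + t * b')\<^sup>2)\<^sup>2) has_real_derivative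
      - 2 * (1 - (b + t * b')\<^sup>2) * (b + t * b') * b') (at t)"
    by (auto intro!: derivative_eq_intros simp: field_simps)
  ultimately have "((\<lambda>t. ?Q t powr (p / 2) + 1 / 2 * (1 - (b + t * b')\<^sup>2)\<^sup>2) has_real_derivative
      p / 2 * ?Q t powr (p / 2 - 1) * (2 * ((a + t * a') * a' + (b + t * b') * b' / r\<^sup>2))
       + - 2 * (1 - (b + t * b')\<^sup>2) * (b + t * b') * b') (at t)"
    by (rule DERIV_add)
  from DERIV_cmult_right[OF this, of r] show ?thesis
    unfolding energy_density_def energy_variation_def
    by (rule DERIV_cong) (simp add: algebra_simps)
qed

text \<open>\<open>y\<close> dominates both components of the gradient, so the sum of squares is at
  most \<open>2 * y\<^sup>2\<close>. The natural constant \<open>2 powr (p / 2 - 1)\<close> is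
  rounded up to \<open>2 powr (p / 2)\<close>.\<close>

lemma gradient_weight_bound:
  fixes p r a b y :: real
  assumes "2 < p" "0 < r" "\<bar>a\<bar> \<le> y" "\<bar>b\<bar> / r \<le> y" "0 < y"
  shows "(a\<^sup>2 + b\<^sup>2 / r\<^sup>2) powr (p / 2 - 1) * y \<le> 2 powr (p / 2) * y powr (p - 1)"
proof -
  have "a\<^sup>2 \<le> y\<^sup>2" "(\<bar>b\<bar> / r)\<^sup>2 \<le> y\<^sup>2"
    using assms by (simp_all add: abs_le_square_iff[symmetric])
  then have "a\<^sup>2 + b\<^sup>2 / r\<^sup>2 \<le> 2 * y\<^sup>2"
    by (simp add: power_divide)
  then have "(a\<^sup>2 + b\<^sup>2 / r\<^sup>2) powr (p / 2 - 1) \<le> (2 * y\<^sup>2) powr (p / 2 - 1)"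
    using assms by (intro powr_mono2) auto
  also have "\<dots> = 2 powr (p / 2 - 1) * (y powr 2) powr (p / 2 - 1)"
    using assms by (simp add: powr_mult)
  also have "(y powr 2) powr (p / 2 - 1) = y powr (p - 2)"
    by (simp add: powr_powr right_diff_distrib)
  also have "2 powr (p / 2 - 1) * y powr (p - 2) \<le> 2 powr (p / 2) * y powr (p - 2)"
    by (intro mult_right_mono powr_mono) auto
  finally have "(a\<^sup>2 + b\<^sup>2 / r\<^sup>2) powr (p / 2 - 1) * y \<le> 2 powr (p / 2) * y powr (p - 2) * y"
    using assms by (intro mult_right_mono) auto
  also have "\<dots> = 2 powr (p / 2) * y powr (p - 1)"
    using assms powr_mult_base[of y "p - 2"] by (simp add: mult_ac)
  finally show ?thesis .
qed

text \<open>Prepares a majorant that is uniform in the variation parameter, later with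
  \<open>y = \<bar>g r\<bar> + M\<close>. The gradient part has degree \<open>p - 1\<close> in
  \<open>y\<close>, the potential part is bounded by a constant, and \<open>y \<ge> 1\<close>
  absorbs both into \<open>y powr p\<close>.\<close>

lemma energy_variation_bound:
  fixes p r a b a' b' y M :: real
  assumes p: "2 < p" and r: "0 < r" "r \<le> M" and M: "1 \<le> M"
    and y: "M \<le> y" "\<bar>a\<bar> \<le> y" "\<bar>b\<bar> / r \<le> y" and b: "\<bar>b\<bar> \<le> M"
    and ab': "\<bar>a'\<bar> \<le> M" "\<bar>b'\<bar> \<le> M" "\<bar>b'\<bar> / r \<le> M"
  shows "\<bar>energy_variation p r a b a' b'\<bar>
    \<le> (2 * p * 2 powr (p / 2) * M\<^sup>2 + 2 * (1 + M\<^sup>2) * M ^ 3) * y powr p"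
proof -
  let ?w = "(a\<^sup>2 + b\<^sup>2 / r\<^sup>2) powr (p / 2 - 1)"
  have y1: "1 \<le> y"
    using M y by simp
  have "\<bar>a * a' + b * b' / r\<^sup>2\<bar> \<le> \<bar>a\<bar> * \<bar>a'\<bar> + (\<bar>b\<bar> / r) * (\<bar>b'\<bar> / r)"
    using r abs_triangle_ineq[of "a * a'" "b * b' / r\<^sup>2"]
    by (simp add: abs_mult power2_eq_square)
  also have "\<dots> \<le> y * M + y * M"
    using assms y1 by (intro add_mono mult_mono) auto
  finally have "\<bar>p * ?w * (a * a' + b * b' / r\<^sup>2)\<bar> \<le> p * ?w * (2 * M * y)"
    using p by (simp add: abs_mult mult_left_mono)
  also have "\<dots> = 2 * p * M * (?w * y)"
    by (simp add: mult_ac)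
  also have "\<dots> \<le> 2 * p * M * (2 powr (p / 2) * y powr (p - 1))"
    using p M y1 r y by (intro mult_left_mono gradient_weight_bound) auto
  also have "\<dots> \<le> 2 * p * M * (2 powr (p / 2) * y powr p)"
    using p M y1 by (intro mult_left_mono powr_mono) auto
  finally have 1: "\<bar>p * ?w * (a * a' + b * b' / r\<^sup>2)\<bar> \<le> 2 * p * M * (2 powr (p / 2) * y powr p)" .
  have "b\<^sup>2 \<le> M\<^sup>2"
    using b M by (simp add: abs_le_square_iff[symmetric])
  then have "\<bar>1 - b\<^sup>2\<bar> \<le> 1 + M\<^sup>2"
    using zero_le_power2[of b] unfolding abs_le_iff by linarith
  then have "\<bar>1 - b\<^sup>2\<bar> * \<bar>b\<bar> * \<bar>b'\<bar> \<le> (1 + M\<^sup>2) * M * M"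
    using b ab' M by (intro mult_mono) auto
  then have "2 * (\<bar>1 - b\<^sup>2\<bar> * \<bar>b\<bar> * \<bar>b'\<bar>) \<le> 2 * ((1 + M\<^sup>2) * M * M)"
    by (rule mult_left_mono) simp
  moreover have "\<bar>2 * (1 - b\<^sup>2) * b * b'\<bar> = 2 * (\<bar>1 - b\<^sup>2\<bar> * \<bar>b\<bar> * \<bar>b'\<bar>)"
    by (simp only: abs_mult mult.assoc abs_numeral)
  ultimately have "\<bar>2 * (1 - b\<^sup>2) * b * b'\<bar> \<le> 2 * (1 + M\<^sup>2) * M\<^sup>2"
    by (simp only: power2_eq_square mult.assoc)
  also have "\<dots> \<le> 2 * (1 + M\<^sup>2) * M\<^sup>2 * y powr p"
    using mult_left_mono[OF ge_one_powr_ge_zero[OF y1, of p], of "2 * (1 + M\<^sup>2) * M\<^sup>2"] p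
    by (simp add: add_nonneg_nonneg)
  finally have 2: "\<bar>2 * (1 - b\<^sup>2) * b * b'\<bar> \<le> 2 * (1 + M\<^sup>2) * M\<^sup>2 * y powr p" .
  have "\<bar>energy_variation p r a b a' b'\<bar>
      = \<bar>p * ?w * (a * a' + b * b' / r\<^sup>2) - 2 * (1 - b\<^sup>2) * b * b'\<bar> * r"
    using r by (simp add: energy_variation_def abs_mult)
  also have "\<dots> \<le> (2 * p * M * (2 powr (p / 2) * y powr p) + 2 * (1 + M\<^sup>2) * M\<^sup>2 * y powr p) * M"
    using r M p 1 2 by (intro mult_mono) auto
  also have "\<dots> = (2 * p * 2 powr (p / 2) * M\<^sup>2 + 2 * (1 + M\<^sup>2) * M ^ 3) * y powr p"
    by (simp add: algebra_simps power2_eq_square power3_eq_cube)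
  finally show ?thesis .
qed

text \<open>Since \<open>s + t \<le> 2 * max s t\<close>, the power of a sum is at most
  \<open>2 powr p\<close> times the sum of the powers.\<close>

lemma loc_int_powr_add:
  assumes "g \<in> Lp_loc p" "0 \<le> M" "0 \<le> p"
  shows "loc_int (\<lambda>r. (\<bar>g r\<bar> + M) powr p)"
proof (rule loc_int_bound)
  have g: "g \<in> borel_measurable (lebesgue_on {0<..})" "loc_int (\<lambda>r. \<bar>g r\<bar> powr p)"
    using assms by (simp_all add: Lp_loc_iff)
  show "loc_int (\<lambda>r. 2 powr p * \<bar>g r\<bar> powr p + 2 powr p * M powr p)"
    by (intro loc_int_add loc_int_cmult g loc_int_continuous continuous_intros)
  show "(\<lambda>r. (\<bar>g r\<bar> + M) powr p) \<in> borel_measurable (lebesgue_on {0<..})"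
    using g(1) by measurable
  fix x :: real
  have "(\<bar>g x\<bar> + M) powr p \<le> (2 * max \<bar>g x\<bar> M) powr p"
    using assms by (intro powr_mono2) auto
  also have "\<dots> = 2 powr p * max \<bar>g x\<bar> M powr p"
    using assms by (simp add: powr_mult)
  also have "\<dots> \<le> 2 powr p * (\<bar>g x\<bar> powr p + M powr p)"
    by (intro mult_left_mono) (auto simp: max_def)
  finally show "\<bar>(\<bar>g x\<bar> + M) powr p\<bar> \<le> 2 powr p * \<bar>g x\<bar> powr p + 2 powr p * M powr p"
    by (simp add: distrib_left)
qed

text \<open>The energy with the derivative as a separate argument, which avoids the choice in \<open>weak_deriv\<close>.\<close>

definition pair_energy :: "real \<Rightarrow> (real \<Rightarrow> real) \<Rightarrow> (real \<Rightarrow> real) \<Rightarrow> ennreal" where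
  "pair_energy p F g = (\<integral>\<^sup>+r. ennreal (energy_density p r (g r) (F r)) \<partial>lebesgue_on {0<..})"

section \<open>The first variation at a minimizing pair\<close>

locale minimizing_pair =
  fixes p :: real and F g :: "real \<Rightarrow> real"
  assumes p: "2 < p" and prim: "primitive F g" and g_Lp: "g \<in> Lp_loc p"
    and finite_energy: "pair_energy p F g < \<infinity>"
    and minimal: "\<And>G h. primitive G h \<Longrightarrow> h \<in> Lp_loc p \<Longrightarrow> pair_energy p G h < \<infinity> \<Longrightarrow>
      pair_energy p F g \<le> pair_energy p G h"
begin

lemma g_measurable [measurable]: "g \<in> borel_measurable (lebesgue_on {0<..})"
  using g_Lp by (simp add: Lp_loc_iff)

lemma F_continuous: "continuous_on {0<..} F"
  using prim by (rule primitive_continuous)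

lemma F_measurable [measurable]: "F \<in> borel_measurable (lebesgue_on {0<..})"
  using F_continuous by (rule continuous_imp_measurable_on_sets_lebesgue) simp

lemma id_measurable [measurable]: "(\<lambda>r::real. r) \<in> borel_measurable (lebesgue_on {0<..})"
  by (rule continuous_imp_measurable_on_sets_lebesgue[OF continuous_on_id]) simp

text \<open>Perturbing by \<open>t * \<phi>\<close> with \<open>t\<close> decreasing to 0 gives
  non-negative difference quotients of the energy. The mean value theorem in \<open>t\<close> bounds
  the integrands by the single integrable function \<open>Y\<close>, so dominated convergence yields
  the limit.\<close>

lemma variation_nonneg:
  assumes \<phi>: "\<phi> \<in> test_functions"
    and ab: "0 < a" "a < b" "\<And>x. x \<notin> {a<..<b} \<Longrightarrow> \<phi> x = 0" "\<And>x. x \<notin> {a<..<b} \<Longrightarrow> deriv \<phi> x = 0"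
  shows "0 \<le> integral {a..b} (\<lambda>r. energy_variation p r (g r) (F r) (deriv \<phi> r) (\<phi> r))"
proof -
  let ?\<phi>' = "deriv \<phi>"
  let ?M0 = "lebesgue_on {0<..} :: real measure"
  have [measurable]: "\<phi> \<in> borel_measurable ?M0" "?\<phi>' \<in> borel_measurable ?M0"
    using test_function_continuous[OF \<phi>] test_function_continuous_deriv[OF \<phi>]
    by (auto intro!: continuous_imp_measurable_on_sets_lebesgue)
  define L where "L t r = energy_density p r (g r + t * ?\<phi>' r) (F r + t * \<phi> r)" for t r
  define V where "V t r = energy_variation p r (g r + t * ?\<phi>' r) (F r + t * \<phi> r) (?\<phi>' r) (\<phi> r)" for t r
  have L_meas [measurable]: "L t \<in> borel_measurable ?M0" for t
    unfolding L_def energy_density_def by measurable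
  have L_deriv: "((\<lambda>t. L t r) has_real_derivative V t r) (at t)" for t r
    unfolding L_def V_def by (rule energy_density_DERIV[OF p])
  \<comment> \<open>Adding non-negative continuous quantities lets one \<open>M\<close> bound each
    of them; the factor \<open>1 + 1 / r\<close> covers both \<open>F\<close>, \<open>\<phi>\<close>
    and their quotients by \<open>r\<close>.\<close>
  obtain M where M: "1 \<le> M" "\<And>r. r \<in> {a..b} \<Longrightarrow>
      r + (1 + 1 / r) * (\<bar>F r\<bar> + \<bar>\<phi> r\<bar>) + \<bar>?\<phi>' r\<bar> \<le> M"
  proof -
    let ?h = "\<lambda>r. r + (1 + 1 / r) * (\<bar>F r\<bar> + \<bar>\<phi> r\<bar>) + \<bar>?\<phi>' r\<bar>"
    have "continuous_on {a..b} F"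
      using F_continuous ab by (auto elim: continuous_on_subset)
    then have "continuous_on {a..b} ?h"
      using ab test_function_continuous[OF \<phi>] test_function_continuous_deriv[OF \<phi>]
      by (intro continuous_intros) auto
    from continuous_on_Icc_abs_bound[OF this] obtain C
      where "1 \<le> C" "\<And>r. r \<in> {a..b} \<Longrightarrow> \<bar>?h r\<bar> \<le> C"
      by blast
    then show ?thesis
      by (intro that[of C]) (auto dest: abs_le_D1)
  qed
  have M2: "r \<le> M" "\<bar>F r\<bar> + \<bar>\<phi> r\<bar> \<le> M" "(\<bar>F r\<bar> + \<bar>\<phi> r\<bar>) / r \<le> M" "\<bar>?\<phi>' r\<bar> \<le> M" if r: "r \<in> {a..b}" for r
  proof -
    have "0 \<le> r" "0 \<le> \<bar>F r\<bar> + \<bar>\<phi> r\<bar>" "0 \<le> (\<bar>F r\<bar> + \<bar>\<phi> r\<bar>) / r" "0 \<le> \<bar>?\<phi>' r\<bar>"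
      using r ab by auto
    moreover have "(1 + 1 / r) * (\<bar>F r\<bar> + \<bar>\<phi> r\<bar>) = (\<bar>F r\<bar> + \<bar>\<phi> r\<bar>) + (\<bar>F r\<bar> + \<bar>\<phi> r\<bar>) / r"
      by (simp add: distrib_right)
    ultimately show "r \<le> M" "\<bar>F r\<bar> + \<bar>\<phi> r\<bar> \<le> M" "(\<bar>F r\<bar> + \<bar>\<phi> r\<bar>) / r \<le> M" "\<bar>?\<phi>' r\<bar> \<le> M"
      using M(2)[OF r] by linarith+
  qed
  define K where "K = 2 * p * 2 powr (p / 2) * M\<^sup>2 + 2 * (1 + M\<^sup>2) * M ^ 3"
  define Y where "Y r = K * (\<bar>g r\<bar> + M) powr p" for r
  have V_bound: "\<bar>V t r\<bar> \<le> Y r" if r: "r \<in> {a..b}" and t: "\<bar>t\<bar> \<le> 1" for t r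
    unfolding V_def Y_def K_def
  proof (rule energy_variation_bound[OF p])
    have r0: "0 < r"
      using r ab by simp
    have 1: "\<bar>t * ?\<phi>' r\<bar> \<le> \<bar>?\<phi>' r\<bar>" "\<bar>t * \<phi> r\<bar> \<le> \<bar>\<phi> r\<bar>"
      using t by (simp_all add: abs_mult mult_left_le_one_le)
    show "0 < r" "r \<le> M" "1 \<le> M" "M \<le> \<bar>g r\<bar> + M" "\<bar>?\<phi>' r\<bar> \<le> M" "\<bar>\<phi> r\<bar> \<le> M"
      using r0 M(1) M2[OF r] by auto
    show "\<bar>g r + t * ?\<phi>' r\<bar> \<le> \<bar>g r\<bar> + M" 
      using 1 M2[OF r] by linarith
    have 2: "\<bar>F r + t * \<phi> r\<bar> \<le> \<bar>F r\<bar> + \<bar>\<phi> r\<bar>"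
      using 1 by linarith
    then show "\<bar>F r + t * \<phi> r\<bar> \<le> M"
      using M2[OF r] by linarith
    have "\<bar>F r + t * \<phi> r\<bar> / r \<le> (\<bar>F r\<bar> + \<bar>\<phi> r\<bar>) / r" "\<bar>\<phi> r\<bar> / r \<le> (\<bar>F r\<bar> + \<bar>\<phi> r\<bar>) / r"
      using r0 2 by (auto intro!: divide_right_mono)
    then show "\<bar>F r + t * \<phi> r\<bar> / r \<le> \<bar>g r\<bar> + M" "\<bar>\<phi> r\<bar> / r \<le> M"
      using M2[OF r] by linarith+
  qed
  have Y_int: "Y integrable_on {a..b}"
    unfolding Y_def using ab p M(1)
    by (intro loc_int_integrable loc_int_cmult loc_int_powr_add g_Lp) auto
  have L_bound: "\<bar>L t r - L 0 r\<bar> \<le> \<bar>t\<bar> * Y r" if r: "r \<in> {a..b}" and t: "0 < t" "t \<le> 1" for t r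
  proof -
    obtain z where "0 < z" "z < t" "L t r - L 0 r = (t - 0) * V z r"
      using MVT2[OF t(1), of "\<lambda>t. L t r" "\<lambda>t. V t r"] L_deriv by blast
    then show ?thesis
      using V_bound[OF r, of z] t by (simp add: abs_mult)
  qed
  have Ldiff_int: "(\<lambda>r. L t r - L 0 r) absolutely_integrable_on {a..b}" if t: "0 < t" "t \<le> 1" for t
  proof (rule measurable_bounded_by_integrable_imp_absolutely_integrable)
    have "(\<lambda>r. L t r - L 0 r) \<in> borel_measurable ?M0"
      by measurable
    then show "(\<lambda>r. L t r - L 0 r) \<in> borel_measurable (lebesgue_on {a..b})"
      by (rule measurable_restrict_mono) (use ab in auto)
    show "(\<lambda>r. \<bar>t\<bar> * Y r) integrable_on {a..b}"
      by (rule integrable_on_mult_right[OF Y_int])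
  qed (use L_bound[OF _ t] in auto)
  have L_nonneg: "0 \<le> L t r" if "0 < r" for t r
    unfolding L_def using that by (rule energy_density_nonneg)
  have L0_int: "integrable ?M0 (L 0)"
  proof (rule integrableI_nonneg)
    show "AE r in ?M0. 0 \<le> L 0 r"
      by (rule AE_I2) (simp add: L_nonneg space_restrict_space)
    show "(\<integral>\<^sup>+r. ennreal (L 0 r) \<partial>?M0) < \<infinity>"
      using finite_energy by (simp add: pair_energy_def L_def)
  qed measurable
  have Ldiff_nonneg: "0 \<le> integral {a..b} (\<lambda>r. L t r - L 0 r)" if t: "0 < t" "t \<le> 1" for t
  proof -
    let ?D = "\<lambda>r. L t r - L 0 r"
    \<comment> \<open>The densities agree off \<open>{a..b}\<close>, so their difference is
      integrable on the whole half-line; with the finite energy of \<open>F\<close> this makes the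
      perturbed energy finite and the two energies subtractable.\<close>
    have D0: "?D r = 0" if "r \<notin> {a..b}" for r
      using ab(3,4)[of r] that by (auto simp: L_def)
    have "(\<lambda>r. indicator {0<..} r *\<^sub>R ?D r) = (\<lambda>r. indicator {a..b} r *\<^sub>R ?D r)"
      using D0 ab by (auto simp: indicator_def fun_eq_iff)
    then have "set_integrable lebesgue {0<..} ?D"
      using Ldiff_int[OF t] by (simp add: set_integrable_def)
    then have D_int: "integrable ?M0 ?D"
      by (simp add: set_integrable_def integrable_restrict_space)
    have D_eq: "(\<integral>r. ?D r \<partial>?M0) = integral {a..b} ?D"
      using set_integral_support[OF ab(1) D0 Ldiff_int[OF t]]
      by (simp add: set_lebesgue_integral_def integral_restrict_space)
    have Lt_int: "integrable ?M0 (L t)"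
      using Bochner_Integration.integrable_add[OF D_int L0_int] by simp
    have E: "(\<integral>\<^sup>+r. ennreal (L s r) \<partial>?M0) = ennreal (\<integral>r. L s r \<partial>?M0)" if "integrable ?M0 (L s)" for s
      using that by (intro nn_integral_eq_integral AE_I2) (auto simp: L_nonneg space_restrict_space)
    have "pair_energy p F g \<le> pair_energy p (\<lambda>r. F r + t * \<phi> r) (\<lambda>r. g r + t * ?\<phi>' r)"
    proof (rule minimal)
      have "primitive \<phi> ?\<phi>'"
        by (intro primitive_of_deriv test_function_DERIV test_function_continuous_deriv \<phi>)
      then show "primitive (\<lambda>r. F r + t * \<phi> r) (\<lambda>r. g r + t * ?\<phi>' r)"
        by (intro primitive_add prim primitive_cmult)
      have "loc_int (\<lambda>r. \<bar>g r + t * ?\<phi>' r\<bar> powr p)"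
      proof (rule loc_int_bound)
        show "loc_int (\<lambda>r. (\<bar>g r\<bar> + M) powr p)"
          using p M(1) by (intro loc_int_powr_add g_Lp) auto
        show "(\<lambda>r. \<bar>g r + t * ?\<phi>' r\<bar> powr p) \<in> borel_measurable ?M0"
          by measurable
        fix r :: real
        \<comment> \<open>Off the support the derivative is 0, so the bound obtained on
          \<open>{a..b}\<close> is global.\<close>
        have "\<bar>?\<phi>' r\<bar> \<le> M"
          using M2(4)[of r] ab(4)[of r] M(1) by (cases "r \<in> {a..b}") auto
        moreover have "\<bar>t * ?\<phi>' r\<bar> \<le> \<bar>?\<phi>' r\<bar>"
          using t by (simp add: abs_mult mult_left_le_one_le)
        ultimately have "\<bar>g r + t * ?\<phi>' r\<bar> \<le> \<bar>g r\<bar> + M"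
          by linarith
        then show "\<bar>\<bar>g r + t * ?\<phi>' r\<bar> powr p\<bar> \<le> (\<bar>g r\<bar> + M) powr p"
          using p by (simp add: powr_mono2)
      qed
      then show "(\<lambda>r. g r + t * ?\<phi>' r) \<in> Lp_loc p"
        by (simp add: Lp_loc_iff)
      show "pair_energy p (\<lambda>r. F r + t * \<phi> r) (\<lambda>r. g r + t * ?\<phi>' r) < \<infinity>"
        using E[OF Lt_int] by (simp add: pair_energy_def L_def)
    qed
    then have "ennreal (\<integral>r. L 0 r \<partial>?M0) \<le> ennreal (\<integral>r. L t r \<partial>?M0)"
      using E[OF L0_int] E[OF Lt_int] by (simp add: pair_energy_def L_def)
    moreover have "0 \<le> (\<integral>r. L t r \<partial>?M0)"
      by (rule integral_nonneg_AE[OF AE_I2]) (simp add: L_nonneg space_restrict_space)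
    ultimately have "(\<integral>r. L 0 r \<partial>?M0) \<le> (\<integral>r. L t r \<partial>?M0)"
      by (simp add: ennreal_le_iff)
    then show ?thesis
      using D_eq Bochner_Integration.integral_diff[OF Lt_int L0_int] by simp
  qed
  define \<tau> where "\<tau> n = inverse (real (Suc n))" for n
  have \<tau>: "0 < \<tau> n" "\<tau> n \<le> 1" for n
    by (simp_all add: \<tau>_def inverse_le_1_iff)
  let ?q = "\<lambda>n r. (L (\<tau> n) r - L 0 r) / \<tau> n"
  have q_int: "?q n integrable_on {a..b}" for n
    by (rule integrable_on_divide[OF set_lebesgue_integral_eq_integral(1)[OF Ldiff_int[OF \<tau>]]])
  have q_nonneg: "0 \<le> integral {a..b} (?q n)" for n
    using Ldiff_nonneg[OF \<tau>, of n] \<tau>[of n] by (simp add: integral_divide)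
  have q_bound: "norm (?q n r) \<le> Y r" if "r \<in> {a..b}" for n r
    using L_bound[OF that \<tau>, of n] \<tau>[of n] by (simp add: field_simps)
  have q_lim: "(\<lambda>n. ?q n r) \<longlonglongrightarrow> V 0 r" for r
  proof -
    have "((\<lambda>t. (L t r - L 0 r) / (t - 0)) \<longlongrightarrow> V 0 r) (at 0)"
      using L_deriv[of r 0] by (simp only: has_field_derivative_iff)
    moreover have "filterlim \<tau> (at 0) sequentially"
      using \<tau>(1) unfolding filterlim_at \<tau>_def
      by (intro conjI LIMSEQ_inverse_real_of_nat always_eventually) auto
    ultimately show ?thesis
      using filterlim_compose by force
  qed
  have "0 \<le> integral {a..b} (V 0)"
    by (rule LIMSEQ_le_const[OF dominated_convergence(2)[OF q_int Y_int q_bound q_lim]]) (assumption | intro exI[of _ 0] allI impI q_nonneg)+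
  then show "0 \<le> integral {a..b} (\<lambda>r. energy_variation p r (g r) (F r) (?\<phi>' r) (\<phi> r))"
    by (simp add: V_def[abs_def])
qed

definition weight where "weight r = p * ((g r)\<^sup>2 + (F r)\<^sup>2 / r\<^sup>2) powr (p / 2 - 1)"

lemma weight_measurable [measurable]: "weight \<in> borel_measurable (lebesgue_on {0<..})"
  unfolding weight_def by measurable

text \<open>One estimate serves both products: \<open>weight r * z\<close> is at most a constant
  times \<open>(\<bar>g r\<bar> + M) powr p\<close> whenever
  \<open>\<bar>z\<bar> \<le> \<bar>g r\<bar> + M\<close>, which covers \<open>z = g r\<close> and
  \<open>z = F r / r\<close>.\<close>

lemma loc_int_weight: "loc_int (\<lambda>r. weight r * g r)" "loc_int (\<lambda>r. weight r * (F r / r))"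
proof -
  have "(\<lambda>r. weight r * g r) absolutely_integrable_on {a..b} \<and>
      (\<lambda>r. weight r * (F r / r)) absolutely_integrable_on {a..b}" if a: "0 < a" for a b
  proof -
    obtain M where M: "1 \<le> M" "\<And>r. r \<in> {a..b} \<Longrightarrow> \<bar>F r / r\<bar> \<le> M"
    proof -
      have "continuous_on {a..b} F"
        using F_continuous a by (auto elim: continuous_on_subset)
      then have "continuous_on {a..b} (\<lambda>r. F r / r)"
        using a by (intro continuous_intros) auto
      then show ?thesis
        using that continuous_on_Icc_abs_bound by blast
    qed
    let ?Y = "\<lambda>r. p * 2 powr (p / 2) * (\<bar>g r\<bar> + M) powr p"
    have bound: "\<bar>weight r * z\<bar> \<le> ?Y r" if r: "r \<in> {a..b}" and z: "\<bar>z\<bar> \<le> \<bar>g r\<bar> + M" for r z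
    proof -
      let ?w = "((g r)\<^sup>2 + (F r)\<^sup>2 / r\<^sup>2) powr (p / 2 - 1)"
      have "\<bar>weight r * z\<bar> \<le> p * (?w * (\<bar>g r\<bar> + M))"
        using p z by (auto simp: weight_def abs_mult intro!: mult_left_mono)
      also have "\<dots> \<le> p * (2 powr (p / 2) * (\<bar>g r\<bar> + M) powr (p - 1))"
        using p M(1) M(2)[OF r] r a by (intro mult_left_mono gradient_weight_bound) auto
      also have "\<dots> \<le> p * (2 powr (p / 2) * (\<bar>g r\<bar> + M) powr p)"
        using p M(1) by (intro mult_left_mono powr_mono) auto
      finally show ?thesis
        by (simp add: mult_ac)
    qed
    have Y_int: "?Y integrable_on {a..b}"
      using a p M(1) by (intro loc_int_integrable loc_int_cmult loc_int_powr_add g_Lp) auto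
    have "(\<lambda>r. weight r * g r) \<in> borel_measurable (lebesgue_on {0<..})"
      "(\<lambda>r. weight r * (F r / r)) \<in> borel_measurable (lebesgue_on {0<..})"
      by measurable
    moreover have "{a..b} \<subseteq> {0<..}"
      using a by auto
    ultimately have meas: "(\<lambda>r. weight r * g r) \<in> borel_measurable (lebesgue_on {a..b})"
      "(\<lambda>r. weight r * (F r / r)) \<in> borel_measurable (lebesgue_on {a..b})"
      by (blast intro: measurable_restrict_mono)+
    show ?thesis
    proof
      show "(\<lambda>r. weight r * g r) absolutely_integrable_on {a..b}"
        by (rule measurable_bounded_by_integrable_imp_absolutely_integrable[OF meas(1) _ Y_int])
          (use bound M(1) in auto)
      have "norm (weight r * (F r / r)) \<le> ?Y r" if "r \<in> {a..b}" for r
        unfolding real_norm_def using M(2)[OF that] by (intro bound[OF that]) linarith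
      then show "(\<lambda>r. weight r * (F r / r)) absolutely_integrable_on {a..b}"
        by (intro measurable_bounded_by_integrable_imp_absolutely_integrable[OF meas(2) _ Y_int]) auto
    qed
  qed
  then show "loc_int (\<lambda>r. weight r * g r)" "loc_int (\<lambda>r. weight r * (F r / r))"
    by (simp_all add: loc_int_def)
qed

text \<open>\<open>energy_variation\<close> is linear in its direction, so the inequalities for
  \<open>\<phi>\<close> and \<open>- \<phi>\<close> force the first variation to vanish. Collecting
  the coefficients of \<open>deriv \<phi>\<close> and \<open>\<phi>\<close> turns this into a
  statement about a weak derivative.\<close>

theorem Euler_Lagrange:
  "has_weak_derivative (\<lambda>r. r * (weight r * g r))
     (\<lambda>r. weight r * (F r / r) - 2 * r * (1 - (F r)\<^sup>2) * F r)" (is "has_weak_derivative ?A ?B")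
  unfolding has_weak_derivative_def
proof (intro conjI ballI)
  have A: "loc_int ?A"
    by (intro loc_int_mult_continuous loc_int_weight continuous_intros)
  have B: "loc_int ?B"
    by (intro loc_int_diff loc_int_weight loc_int_continuous continuous_intros F_continuous)
  show "?A \<in> Lp_loc 1" "?B \<in> Lp_loc 1"
    using A B by (simp_all add: Lp_loc_1_iff)
  fix \<phi> assume \<phi>: "\<phi> \<in> test_functions"
  from test_function_support[OF this] obtain a b where ab: "0 < a" "a < b"
      "\<And>x. x \<notin> {a<..<b} \<Longrightarrow> \<phi> x = 0" "\<And>x. x \<notin> {a<..<b} \<Longrightarrow> deriv \<phi> x = 0"
    by blast
  let ?V = "\<lambda>r. energy_variation p r (g r) (F r) (deriv \<phi> r) (\<phi> r)"
  have neg: "(\<lambda>x. - \<phi> x) \<in> test_functions"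
  proof -
    have "C_infinity_on UNIV \<phi>" "\<exists>K. compact K \<and> K \<subseteq> {0<..} \<and> (\<forall>x. x \<notin> K \<longrightarrow> \<phi> x = 0)"
      using \<phi> by (auto simp: test_functions_def)
    then show ?thesis
      by (auto simp: test_functions_def C_infinity_on_iff_ndiff)
  qed
  have deriv_neg: "deriv (\<lambda>x. - \<phi> x) x = - deriv \<phi> x" for x
    by (intro DERIV_imp_deriv DERIV_minus test_function_DERIV \<phi>)
  have "0 \<le> integral {a..b} ?V"
    using variation_nonneg[OF \<phi> ab] .
  moreover have "0 \<le> integral {a..b} (\<lambda>r. energy_variation p r (g r) (F r) (deriv (\<lambda>x. - \<phi> x) r) (- \<phi> r))"
    using ab by (intro variation_nonneg[OF neg]) (auto simp: deriv_neg)
  moreover have "(\<lambda>r. energy_variation p r (g r) (F r) (deriv (\<lambda>x. - \<phi> x) r) (- \<phi> r)) = (\<lambda>r. - ?V r)"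
    by (rule ext) (simp add: energy_variation_def deriv_neg algebra_simps)
  ultimately have "0 = integral {a..b} ?V"
    by simp
  also have "\<dots> = integral {a..b} (\<lambda>r. ?A r * deriv \<phi> r + ?B r * \<phi> r)"
  proof (rule integral_cong)
    fix r assume "r \<in> {a..b}"
    then show "?V r = ?A r * deriv \<phi> r + ?B r * \<phi> r"
      using ab(1) by (simp add: energy_variation_def weight_def field_simps power2_eq_square)
  qed
  also have "\<dots> = integral {a..b} (\<lambda>r. ?A r * deriv \<phi> r) + integral {a..b} (\<lambda>r. ?B r * \<phi> r)"
    by (intro Henstock_Kurzweil_Integration.integral_add loc_int_integrable loc_int_mult_test A B \<phi> ab)
  finally show "(LINT r:{0<..}|lebesgue. ?A r * deriv \<phi> r) = - (LINT r:{0<..}|lebesgue. ?B r * \<phi> r)"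
    using set_integral_test(2)[OF A \<phi>, of a b] set_integral_test(1)[OF B \<phi>, of a b] ab by simp
qed

end

section \<open>From the minimizer to a minimizing pair\<close>

lemma pair_energy_eq:
  assumes "AE r in lebesgue. 0 < r \<longrightarrow> f r = F r" "AE r in lebesgue. 0 < r \<longrightarrow> weak_deriv f r = g r"
  shows "energy p f = pair_energy p F g"
proof -
  have "energy p f = (\<integral>\<^sup>+r\<in>{0<..}. ennreal (energy_density p r (g r) (F r)) \<partial>lebesgue)"
    unfolding energy_def
  proof (rule nn_integral_cong_AE)
    show "AE r in lebesgue. ennreal ((((weak_deriv f r)\<^sup>2 + (f r)\<^sup>2 / r\<^sup>2) powr (p / 2)
        + 1 / 2 * (1 - (f r)\<^sup>2)\<^sup>2) * r) * indicator {0<..} r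
      = ennreal (energy_density p r (g r) (F r)) * indicator {0<..} r"
      using assms by eventually_elim (simp add: energy_density_def indicator_def)
  qed
  also have "\<dots> = pair_energy p F g"
    unfolding pair_energy_def by (subst nn_integral_restrict_space) auto
  finally show ?thesis .
qed

lemma primitive_in_W1p_loc:
  assumes "primitive F g" "g \<in> Lp_loc p" "0 < p"
  shows "F \<in> W1p_loc p"
proof -
  have F: "continuous_on {0<..} F"
    using assms(1) by (rule primitive_continuous)
  have "loc_int (\<lambda>r. \<bar>F r\<bar> powr p)"
    using assms(3) by (intro loc_int_continuous continuous_on_powr' continuous_intros F) auto
  moreover have "F \<in> borel_measurable (lebesgue_on {0<..})"
    using F by (rule continuous_imp_measurable_on_sets_lebesgue) simp
  ultimately have "F \<in> Lp_loc p"
    by (simp add: Lp_loc_iff)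
  with assms primitive_has_weak_derivative[OF assms(1)] show ?thesis
    by (auto simp: W1p_loc_def)
qed

text \<open>The potential term is non-negative, so the energy bounds the integral that defines
  \<open>X_space\<close>.\<close>

lemma primitive_in_X_space:
  assumes F: "primitive F g" "g \<in> Lp_loc p" "0 < p" and fin: "pair_energy p F g < \<infinity>"
  shows "F \<in> X_space p"
proof -
  have wd: "AE r in lebesgue. 0 < r \<longrightarrow> weak_deriv F r = g r"
    by (intro weak_deriv_AE primitive_has_weak_derivative F)
  have "(\<integral>\<^sup>+r\<in>{0<..}. ennreal ((\<bar>weak_deriv F r\<bar>\<^sup>2 + (F r)\<^sup>2 / r\<^sup>2) powr (p / 2) * r) \<partial>lebesgue)
    \<le> energy p F"
    unfolding energy_def
    by (intro nn_integral_mono) (auto simp: indicator_def intro!: ennreal_leI mult_right_mono)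
  also have "\<dots> = pair_energy p F g"
    by (rule pair_energy_eq[OF _ wd]) simp
  also note fin
  finally show ?thesis
    using primitive_in_W1p_loc[OF F] by (simp add: X_space_def)
qed

text \<open>The function \<open>r \<mapsto> min r 1\<close> is a competitor of finite energy; integrability at infinity of
  \<open>(f / r) powr p * r = r powr (1 - p)\<close> is where \<open>p > 2\<close> enters.\<close>

lemma primitive_min_1:
  "primitive (\<lambda>r. min r 1) (\<lambda>r. if r \<le> 1 then 1 else 0)"
proof -
  let ?h = "\<lambda>r::real. if r \<le> 1 then 1 else (0::real)"
  have 1: "(?h has_integral min b 1 - min a 1) {a..b}" if "a \<le> b" for a b
    using that
    by (intro fundamental_theorem_of_calculus_interior_strong[of "{1}"])
      (auto intro!: continuous_intros
        intro: has_vector_derivative_transform_within_open[of "\<lambda>x. x" _ _ "{..<1}"]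
          has_vector_derivative_transform_within_open[of "\<lambda>x. 1" _ _ "{1<..}"])
  moreover have "loc_int ?h"
    unfolding loc_int_def
  proof (intro allI impI)
    fix a b :: real
    show "?h absolutely_integrable_on {a..b}"
    proof (cases "a \<le> b")
      case True
      from 1[OF this] show ?thesis
        by (intro nonnegative_absolutely_integrable_1) (auto dest: has_integral_integrable)
    qed auto
  qed
  ultimately show ?thesis
    by (simp add: primitive_def)
qed

lemma Lp_loc_min_1_deriv:
  assumes "0 < p" shows "(\<lambda>r. if r \<le> 1 then 1 else 0) \<in> Lp_loc p"
proof -
  have h: "loc_int (\<lambda>r::real. if r \<le> 1 then 1 else (0::real))"
    using primitive_min_1 by (rule primitive_loc_int)
  moreover have "(\<lambda>r::real. \<bar>if r \<le> 1 then 1 else (0::real)\<bar> powr p) = (\<lambda>r. if r \<le> 1 then 1 else 0)"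
    using assms by auto
  ultimately show ?thesis
    using loc_int_measurable[OF h] by (simp add: Lp_loc_iff)
qed

lemma pair_energy_min_1:
  assumes p: "2 < p"
  shows "pair_energy p (\<lambda>r. min r 1) (\<lambda>r. if r \<le> 1 then 1 else 0) < \<infinity>"
proof -
  let ?h = "\<lambda>r::real. if r \<le> 1 then 1 else (0::real)"
  let ?C = "2 powr (p / 2) + 1"
  \<comment> \<open>Up to radius 1 the slope and the quotient of value by radius are both 1, which
    gives \<open>2 powr (p / 2)\<close>, and the potential is at most 1/2. Beyond radius 1 the slope
    and the potential vanish.\<close>
  have le: "energy_density p r (?h r) (min r 1) \<le> ?C * indicator {0..1} r + r powr (1 - p) * indicator {1..} r"
    if r: "0 < r" for r
  proof (cases "r \<le> 1")
    case True
    have "(1 - r\<^sup>2)\<^sup>2 \<le> 1"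
      using r True by (simp add: power_le_one)
    then have "(2 powr (p / 2) + 1 / 2 * (1 - r\<^sup>2)\<^sup>2) * r \<le> ?C * 1"
      using r True by (intro mult_mono) auto
    then show ?thesis
      using r True by (auto simp: energy_density_def min_def intro: add_increasing2)
  next
    case False
    have "(1 / r\<^sup>2) powr (p / 2) * r = r powr (1 - p)"
    proof -
      have "1 / r\<^sup>2 = r powr (-2)"
        using r by (simp add: powr_minus divide_inverse)
      then have "(1 / r\<^sup>2) powr (p / 2) * r = r powr (- p) * r powr 1"
        using r by (simp add: powr_powr)
      also have "\<dots> = r powr (1 - p)"
        by (simp only: powr_add[symmetric]) simp
      finally show ?thesis .
    qed
    with False show ?thesis
      by (simp add: energy_density_def min_def indicator_def)
  qed
  have "pair_energy p (\<lambda>r. min r 1) ?h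
      = (\<integral>\<^sup>+r\<in>{0<..}. ennreal (energy_density p r (?h r) (min r 1)) \<partial>lebesgue)"
    unfolding pair_energy_def by (subst nn_integral_restrict_space) auto
  also have "\<dots> = (\<integral>\<^sup>+r\<in>{0<..}. ennreal (energy_density p r (?h r) (min r 1)) \<partial>lborel)"
    by (rule nn_integral_completion)
  also have "\<dots> \<le> (\<integral>\<^sup>+r. ennreal ?C * indicator {0..1} r + ennreal (r powr (1 - p)) * indicator {1..} r \<partial>lborel)"
  proof (rule nn_integral_mono)
    fix r :: real
    have "ennreal (energy_density p r (?h r) (min r 1))
        \<le> ennreal ?C * indicator {0..1} r + ennreal (r powr (1 - p)) * indicator {1..} r" if "0 < r"
      using ennreal_leI[OF le[OF that]]
      by (simp add: ennreal_plus ennreal_mult ennreal_indicator split: split_indicator)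
    then show "ennreal (energy_density p r (?h r) (min r 1)) * indicator {0<..} r
        \<le> ennreal ?C * indicator {0..1} r + ennreal (r powr (1 - p)) * indicator {1..} r"
      by (auto split: split_indicator)
  qed
  also have "\<dots> = ennreal ?C + (\<integral>\<^sup>+r. ennreal (r powr (1 - p)) * indicator {1..} r \<partial>lborel)"
    by (subst nn_integral_add) (auto simp: nn_integral_cmult_indicator)
  also have "(\<integral>\<^sup>+r. ennreal (r powr (1 - p)) * indicator {1..} r \<partial>lborel) = ennreal (0 - 1 powr (2 - p) / (2 - p))"
  proof (rule nn_integral_FTC_atLeast)
    show "DERIV (\<lambda>r. r powr (2 - p) / (2 - p)) r :> r powr (1 - p)" if "1 \<le> r" for r
      using that p by (auto intro!: derivative_eq_intros)
    have "((\<lambda>r. r powr (2 - p)) \<longlongrightarrow> 0) at_top"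
      using p by (intro tendsto_neg_powr filterlim_ident) auto
    then show "((\<lambda>r. r powr (2 - p) / (2 - p)) \<longlongrightarrow> 0) at_top"
      by (auto intro: tendsto_divide_zero)
  qed auto
  also have "ennreal ?C + \<dots> < \<infinity>"
    by simp
  finally show ?thesis .
qed

text \<open>A pair of finite energy is an element of \<open>X_space\<close> whose
  \<open>energy\<close> is its \<open>pair_energy\<close>, so minimality passes to pairs; comparison
  with \<open>min r 1\<close> makes the minimal energy finite.\<close>

lemma nonneg_minimizer_pair:
  assumes p: "2 < p" and f: "nonneg_minimizer p f"
  obtains F g where "minimizing_pair p F g" "AE r in lebesgue. 0 < r \<longrightarrow> f r = F r"
proof -
  obtain g where g: "g \<in> Lp_loc p" "has_weak_derivative f g"
    using f by (auto simp: nonneg_minimizer_def X_space_def W1p_loc_def)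
  obtain F where F: "primitive F g" "AE r in lebesgue. 0 < r \<longrightarrow> f r = F r"
    using weak_derivative_primitive[OF g(2)] .
  have f_energy: "energy p f = pair_energy p F g"
    using F(2) weak_deriv_AE[OF g(2)] by (rule pair_energy_eq)
  have min: "pair_energy p F g \<le> pair_energy p G h"
    if "primitive G h" "h \<in> Lp_loc p" "pair_energy p G h < \<infinity>" for G h
  proof -
    have "G \<in> X_space p"
      using that p by (intro primitive_in_X_space) auto
    then have "energy p f \<le> energy p G"
      using f by (simp add: nonneg_minimizer_def)
    also have "energy p G = pair_energy p G h"
      using weak_deriv_AE[OF primitive_has_weak_derivative[OF that(1)]] by (intro pair_energy_eq) auto
    finally show ?thesis
      by (simp add: f_energy)
  qed
  have "pair_energy p F g \<le> pair_energy p (\<lambda>r. min r 1) (\<lambda>r. if r \<le> 1 then 1 else 0)"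
    using p by (intro min primitive_min_1 Lp_loc_min_1_deriv pair_energy_min_1) auto
  also note pair_energy_min_1[OF p]
  finally have "minimizing_pair p F g"
    using p F(1) g(1) min by unfold_locales auto
  with F(2) show ?thesis
    using that by blast
qed

section \<open>The classical equation and positivity\<close>

definition flux_weight :: "real \<Rightarrow> real \<Rightarrow> real \<Rightarrow> real" where
  "flux_weight p s c = p * (s\<^sup>2 + c) powr (p / 2 - 1)"

text \<open>\<open>c\<close> stands for \<open>(F r)\<^sup>2 / r\<^sup>2\<close>. Keeping it as an
  independent parameter allows inversion in \<open>s\<close> while \<open>c\<close> varies with the
  radius.\<close>

definition flux :: "real \<Rightarrow> real \<Rightarrow> real \<Rightarrow> real" where
  "flux p s c = flux_weight p s c * s"

lemma flux_minus: "flux p (- s) c = - flux p s c"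
  by (simp add: flux_def flux_weight_def)

lemma flux_pos:
  assumes "2 < p" "0 \<le> c" "0 < s" shows "0 < flux p s c"
proof -
  have "s\<^sup>2 + c \<noteq> 0"
    using assms by (simp add: add_pos_nonneg order_less_imp_not_eq2)
  then show ?thesis
    using assms by (simp add: flux_def flux_weight_def)
qed

text \<open>For \<open>0 \<le> s\<close> the weight is nondecreasing and the factor \<open>s\<close>
  grows. Oddness transfers this to negative slopes, and slopes of opposite sign are compared through
  0.\<close>

lemma flux_mono_strict:
  assumes p: "2 < p" and c: "0 \<le> c" and st: "s < t"
  shows "flux p s c < flux p t c"
proof -
  have pos: "flux p s c < flux p t c" if "0 \<le> s" "s < t" for s t
  proof -
    have "s\<^sup>2 \<le> t\<^sup>2"
      using that by (intro power_mono) auto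
    then have "flux_weight p s c \<le> flux_weight p t c"
      using p c unfolding flux_weight_def by (intro mult_left_mono powr_mono2) auto
    then have "flux p s c \<le> flux_weight p t c * s"
      using that unfolding flux_def by (intro mult_right_mono) auto
    also have "\<dots> < flux_weight p t c * t"
      using flux_pos[OF p c, of t] that
      by (intro mult_strict_left_mono) (auto simp: flux_def zero_less_mult_iff)
    finally show ?thesis
      by (simp add: flux_def)
  qed
  consider "0 \<le> s" | "t \<le> 0" | "s < 0" "0 < t"
    by linarith
  then show ?thesis
  proof cases
    case 1
    with pos st show ?thesis by blast
  next
    case 2
    with pos[of "- t" "- s"] st show ?thesis
      by (simp add: flux_minus)
  next
    case 3
    with flux_pos[OF p c, of t] flux_pos[OF p c, of "- s"] show ?thesis
      by (simp add: flux_minus)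
  qed
qed

lemma flux_less_iff: "2 < p \<Longrightarrow> 0 \<le> c \<Longrightarrow> flux p s c < flux p t c \<longleftrightarrow> s < t"
  using flux_mono_strict by (metis less_asym linorder_neqE_linordered_idom)

lemma flux_eq_iff: "2 < p \<Longrightarrow> 0 \<le> c \<Longrightarrow> flux p s c = flux p t c \<longleftrightarrow> s = t"
  using flux_mono_strict by (metis less_irrefl linorder_neqE_linordered_idom)

lemma flux_0 [simp]: "flux p 0 c = 0"
  by (simp add: flux_def)

lemma tendsto_flux_weight:
  assumes "2 < p" "(s \<longlongrightarrow> s0) A" "(c \<longlongrightarrow> c0) A" "\<And>x. 0 \<le> c x"
  shows "((\<lambda>x. flux_weight p (s x) (c x)) \<longlongrightarrow> flux_weight p s0 c0) A"
  unfolding flux_weight_def using assms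
  by (intro tendsto_mult tendsto_const tendsto_powr' tendsto_add tendsto_power)
    (auto intro!: always_eventually add_nonneg_nonneg)

lemma tendsto_flux:
  assumes "2 < p" "(s \<longlongrightarrow> s0) A" "(c \<longlongrightarrow> c0) A" "\<And>x. 0 \<le> c x"
  shows "((\<lambda>x. flux p (s x) (c x)) \<longlongrightarrow> flux p s0 c0) A"
  unfolding flux_def by (intro tendsto_mult tendsto_flux_weight assms)

lemma flux_surj:
  assumes p: "2 < p" and c: "0 \<le> c"
  obtains s where "flux p s c = a"
proof -
  have ex: "\<exists>s. flux p s c = a" if "0 \<le> a" for a
  proof -
    \<comment> \<open>For \<open>T \<ge> 1\<close> the base of the power is at least 1, so the
      weight is at least 1 and the flux at \<open>T\<close> is at least \<open>T\<close>.\<close>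
    define T where "T = max 1 a"
    have "1 \<le> (T\<^sup>2 + c) powr (p / 2 - 1)"
      using c p by (intro ge_one_powr_ge_zero) (auto simp: T_def add_increasing2 one_le_power)
    then have "1 * 1 * T \<le> flux p T c"
      unfolding flux_def flux_weight_def using p by (intro mult_right_mono mult_mono) (auto simp: T_def)
    then have "a \<le> flux p T c"
      by (simp add: T_def)
    moreover have "isCont (\<lambda>s. flux p s c) s" for s
      unfolding isCont_def by (intro tendsto_flux p tendsto_ident_at tendsto_const c)
    moreover have "0 \<le> T"
      by (simp add: T_def)
    ultimately show ?thesis
      using IVT[of "\<lambda>s. flux p s c" 0 a T] that by auto
  qed
  show ?thesis
  proof (cases "0 \<le> a")
    case True
    with ex that show ?thesis by blast
  next
    case False
    then obtain s where "flux p s c = - a"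
      using ex[of "- a"] by auto
    then show ?thesis
      using that[of "- s"] by (simp add: flux_minus)
  qed
qed

text \<open>By strict monotonicity, \<open>l < s x\<close> is the positivity of
  \<open>flux p (s x) (c x) - flux p l (c x)\<close>. This difference converges to a nonzero limit
  for each \<open>l \<noteq> s0\<close>, so its sign is eventually that of the limit.\<close>

lemma tendsto_flux_inverse:
  assumes p: "2 < p" and c: "(c \<longlongrightarrow> c0) A" "\<And>x. 0 \<le> c x" "0 \<le> c0"
    and a: "((\<lambda>x. flux p (s x) (c x)) \<longlongrightarrow> flux p s0 c0) A"
  shows "(s \<longlongrightarrow> s0) A"
proof -
  have lim: "((\<lambda>x. flux p (s x) (c x) - flux p l (c x)) \<longlongrightarrow> flux p s0 c0 - flux p l c0) A" for l
    by (intro tendsto_diff a tendsto_flux p tendsto_const c)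
  show ?thesis
  proof (rule order_tendstoI)
    fix l assume "l < s0"
    then have "0 < flux p s0 c0 - flux p l c0"
      using flux_mono_strict[OF p c(3)] by simp
    with lim have "\<forall>\<^sub>F x in A. 0 < flux p (s x) (c x) - flux p l (c x)"
      by (rule order_tendstoD)
    then show "\<forall>\<^sub>F x in A. l < s x"
      by eventually_elim (use flux_less_iff[OF p c(2)] in simp)
  next
    fix l assume "s0 < l"
    then have "flux p s0 c0 - flux p l c0 < 0"
      using flux_mono_strict[OF p c(3)] by simp
    with lim have "\<forall>\<^sub>F x in A. flux p (s x) (c x) - flux p l (c x) < 0"
      by (rule order_tendstoD)
    then show "\<forall>\<^sub>F x in A. s x < l"
      by eventually_elim (use flux_less_iff[OF p c(2)] in simp)
  qed
qed

text \<open>The classical form available before positivity is known: \<open>u\<close> is C^1 and the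
  flux is differentiable, while \<open>v\<close> is merely continuous.\<close>

locale radial_ode =
  fixes p :: real and u v :: "real \<Rightarrow> real"
  assumes p: "2 < p"
    and v_cont: "continuous_on {0<..} v"
    and u_DERIV: "\<And>r. 0 < r \<Longrightarrow> (u has_real_derivative v r) (at r)"
    and flux_DERIV: "\<And>r. 0 < r \<Longrightarrow> ((\<lambda>r. r * flux p (v r) ((u r)\<^sup>2 / r\<^sup>2)) has_real_derivative
      flux_weight p (v r) ((u r)\<^sup>2 / r\<^sup>2) * (u r / r) - 2 * r * (1 - (u r)\<^sup>2) * u r) (at r)"

text \<open>The weak equation gives a continuous representative \<open>A\<close> of the flux times
  \<open>r\<close>. Solving for the slope at every point defines \<open>v\<close>; injectivity of
  the flux gives \<open>v = g\<close> almost everywhere, and continuous dependence of its inverse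
  gives continuity.\<close>

lemma (in minimizing_pair) radial_ode:
  obtains v where "radial_ode p F v"
proof -
  let ?c = "\<lambda>r. (F r)\<^sup>2 / r\<^sup>2"
  have weight_eq: "weight r = flux_weight p (g r) (?c r)" for r
    by (simp add: weight_def flux_weight_def)
  obtain A where A: "primitive A (\<lambda>r. weight r * (F r / r) - 2 * r * (1 - (F r)\<^sup>2) * F r)"
      "AE r in lebesgue. 0 < r \<longrightarrow> r * (weight r * g r) = A r"
    using weak_derivative_primitive[OF Euler_Lagrange] .
  have "\<exists>s. flux p s (?c r) = A r / r" for r
    using flux_surj[OF p, of "?c r" "A r / r"] by fastforce
  then obtain v where v: "\<And>r. flux p (v r) (?c r) = A r / r"
    by metis
  have g_v: "AE r in lebesgue. 0 < r \<longrightarrow> g r = v r"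
    using A(2)
  proof eventually_elim
    case (elim r)
    have "flux p (g r) (?c r) = flux p (v r) (?c r)" if "0 < r"
      using elim that unfolding v weight_eq by (simp add: flux_def field_simps)
    then show ?case
      using flux_eq_iff[OF p, of "?c r"] by simp
  qed
  have A_cont: "continuous_on {0<..} A"
    using A(1) by (rule primitive_continuous)
  have lim: "(F \<longlongrightarrow> F r) (at r)" "(A \<longlongrightarrow> A r) (at r)" "(?c \<longlongrightarrow> ?c r) (at r)" if "0 < r" for r
  proof -
    show "(F \<longlongrightarrow> F r) (at r)" "(A \<longlongrightarrow> A r) (at r)"
      using F_continuous A_cont that by (auto simp: continuous_on_eq_continuous_at isCont_def)
    then show "(?c \<longlongrightarrow> ?c r) (at r)"
      using that by (intro tendsto_intros) auto
  qed
  have v_lim: "(v \<longlongrightarrow> v r) (at r)" if r: "0 < r" for r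
  proof (rule tendsto_flux_inverse[OF p lim(3)[OF r]])
    show "((\<lambda>x. flux p (v x) (?c x)) \<longlongrightarrow> flux p (v r) (?c r)) (at r)"
      unfolding v using r by (intro tendsto_divide lim tendsto_ident_at) auto
  qed auto
  then have v_cont: "continuous_on {0<..} v"
    by (auto simp: continuous_on_eq_continuous_at isCont_def)
  let ?B = "\<lambda>r. flux_weight p (v r) (?c r) * (F r / r) - 2 * r * (1 - (F r)\<^sup>2) * F r"
  have B_cont: "continuous_on {0<..} ?B"
    unfolding continuous_on_eq_continuous_at[OF open_greaterThan] isCont_def
  proof (intro ballI)
    fix r :: real assume "r \<in> {0<..}"
    then show "(?B \<longlongrightarrow> ?B r) (at r)"
      by (intro tendsto_intros tendsto_flux_weight p v_lim lim) auto
  qed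
  \<comment> \<open>Replacing \<open>g\<close> by \<open>v\<close> alters the integrand on a null
    set and makes it continuous, so \<open>A\<close> becomes classically differentiable.\<close>
  have "primitive A ?B"
  proof (rule primitive_cong_AE[OF A(1)])
    show "AE r in lebesgue. 0 < r \<longrightarrow> weight r * (F r / r) - 2 * r * (1 - (F r)\<^sup>2) * F r = ?B r"
      using g_v by eventually_elim (simp add: weight_eq)
  qed
  from primitive_deriv[OF this B_cont]
  have A_DERIV: "(A has_real_derivative ?B r) (at r)" if "0 < r" for r
    using that .
  have "((\<lambda>r. r * flux p (v r) (?c r)) has_real_derivative ?B r) (at r)" if "0 < r" for r
    by (rule has_field_derivative_transform_within_open[OF A_DERIV open_greaterThan[of 0]])
      (use that v in auto)
  moreover have "(F has_real_derivative v r) (at r)" if "0 < r" for r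
    using primitive_deriv[OF primitive_cong_AE[OF prim g_v] v_cont that] .
  ultimately have "radial_ode p F v"
    using p v_cont by unfold_locales auto
  then show ?thesis
    by (rule that)
qed

section \<open>Zeros of a non-negative solution\<close>

context radial_ode
begin

abbreviation (input) "q r \<equiv> (u r)\<^sup>2 / r\<^sup>2"

lemma u_lim: "0 < r \<Longrightarrow> (u \<longlongrightarrow> u r) (at r)"
  using DERIV_isCont[OF u_DERIV] by (simp add: isCont_def)

lemma v_lim: "0 < r \<Longrightarrow> (v \<longlongrightarrow> v r) (at r)"
  using v_cont by (auto simp: continuous_on_eq_continuous_at isCont_def)

lemma q_lim: "0 < r \<Longrightarrow> (q \<longlongrightarrow> q r) (at r)"
  by (intro tendsto_intros u_lim) auto

text \<open>Near a zero the term \<open>- 2 * r * u\<close> dominates the right-hand side of the equation, so the flux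
  decreases through zero and \<open>u\<close> has a local maximum there.\<close>

lemma zero_nbhd:
  assumes nonneg: "\<And>r. 0 < r \<Longrightarrow> 0 \<le> u r" and r0: "0 < r0" "u r0 = 0"
  obtains e where "0 < e" "e \<le> r0" "\<And>r. \<bar>r - r0\<bar> < e \<Longrightarrow> u r = 0"
proof -
  let ?A = "\<lambda>r. r * flux p (v r) (q r)"
  \<comment> \<open>\<open>?h\<close> is the right-hand side of the equation with a factor
    \<open>u\<close> taken out. At \<open>r0\<close> both \<open>u\<close> and \<open>v\<close>
    vanish, and the weight tends to 0 because its exponent is positive, which leaves the limit
    \<open>- 2 * r0\<close>.\<close>
  let ?h = "\<lambda>r. flux_weight p (v r) (q r) / r - 2 * r * (1 - (u r)\<^sup>2)"
  have v0: "v r0 = 0"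
    using u_DERIV[OF r0(1)] r0(1)
    by (rule DERIV_local_min) (use r0 nonneg in auto)
  have "(?h \<longlongrightarrow> ?h r0) (at r0)"
    using r0 by (intro tendsto_intros tendsto_flux_weight p v_lim q_lim u_lim) auto
  moreover have "?h r0 = - 2 * r0"
    using p r0 v0 by (simp add: flux_weight_def)
  ultimately have "\<forall>\<^sub>F r in at r0. ?h r < 0"
    using r0 by (intro order_tendstoD) auto
  then obtain d where d: "0 < d" "\<And>r. r \<noteq> r0 \<Longrightarrow> \<bar>r - r0\<bar> < d \<Longrightarrow> ?h r < 0"
    unfolding eventually_at by (auto simp: dist_real_def)
  define e where "e = min d r0"
  have e: "0 < e" "e \<le> r0"
    using d r0 by (auto simp: e_def)
  have pos: "0 < r" if "\<bar>r - r0\<bar> < e" for r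
    using that e by linarith
  have A_DERIV: "(?A has_real_derivative ?h r * u r) (at r)" if "\<bar>r - r0\<bar> < e" for r
    by (rule DERIV_cong[OF flux_DERIV[OF pos[OF that]]]) (simp add: algebra_simps)
  \<comment> \<open>The sign of \<open>?h\<close> comes from a punctured neighbourhood; at
    \<open>r0\<close> the factor \<open>u r0 = 0\<close> settles the claim.\<close>
  have A_nonpos: "?h r * u r \<le> 0" if "\<bar>r - r0\<bar> < e" for r
    using d(2)[of r] that nonneg[OF pos[OF that]] r0
    by (cases "r = r0") (auto simp: e_def mult_nonpos_nonneg less_imp_le)
  have A_mono: "?A t \<le> ?A s" if "s \<le> t" "\<bar>s - r0\<bar> < e" "\<bar>t - r0\<bar> < e" for s t
  proof (rule DERIV_nonpos_imp_nonincreasing[OF that(1)])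
    fix x assume "s \<le> x" "x \<le> t"
    then have "\<bar>x - r0\<bar> < e"
      using that by linarith
    then show "\<exists>y. (?A has_real_derivative y) (at x) \<and> y \<le> 0"
      using A_DERIV A_nonpos by blast
  qed
  have A0: "?A r0 = 0"
    by (simp add: v0)
  have right: "v r \<le> 0" if "r0 \<le> r" "\<bar>r - r0\<bar> < e" for r
  proof (rule ccontr)
    assume "\<not> v r \<le> 0"
    then have "0 < ?A r"
      using pos[OF that(2)] by (intro mult_pos_pos flux_pos p) auto
    with A_mono[of r0 r] A0 that e show False by simp
  qed
  have left: "0 \<le> v r" if "r \<le> r0" "\<bar>r - r0\<bar> < e" for r
  proof (rule ccontr)
    assume "\<not> 0 \<le> v r"
    then have "0 < r * flux p (- v r) (q r)"
      using pos[OF that(2)] by (intro mult_pos_pos flux_pos p) auto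
    with A_mono[of r r0] A0 that e show False by (simp add: flux_minus)
  qed
  have "u r \<le> u r0" if r: "\<bar>r - r0\<bar> < e" for r
  proof (cases "r0 \<le> r")
    case True
    then show ?thesis
    proof (rule DERIV_nonpos_imp_nonincreasing)
      fix x assume "r0 \<le> x" "x \<le> r"
      then have "\<bar>x - r0\<bar> < e" "r0 \<le> x"
        using r by linarith+
      then show "\<exists>y. (u has_real_derivative y) (at x) \<and> y \<le> 0"
        using u_DERIV pos right by blast
    qed
  next
    case False
    then have "r \<le> r0"
      by simp
    then show ?thesis
    proof (rule DERIV_nonneg_imp_nondecreasing)
      fix x assume "r \<le> x" "x \<le> r0"
      then have "\<bar>x - r0\<bar> < e" "x \<le> r0"
        using r by linarith+
      then show "\<exists>y. (u has_real_derivative y) (at x) \<and> 0 \<le> y"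
        using u_DERIV pos left by blast
    qed
  qed
  then have "u r = 0" if "\<bar>r - r0\<bar> < e" for r
    using that nonneg[OF pos[OF that]] r0 by (simp add: order_antisym)
  with e show ?thesis
    using that by blast
qed

text \<open>\<open>zero_nbhd\<close> makes the zero set open, continuity makes it relatively closed,
  and the half-line is connected.\<close>

lemma positive_or_zero:
  assumes nonneg: "\<And>r. 0 < r \<Longrightarrow> 0 \<le> u r"
  shows "(\<forall>r>0. u r = 0) \<or> (\<forall>r>0. 0 < u r)"
proof -
  let ?Z = "{r \<in> {0<..}. u r = 0}"
  have "continuous_on {0<..} u"
    using u_lim by (auto simp: continuous_on_eq_continuous_at isCont_def)
  then have "closedin (top_of_set {0<..}) ?Z"
    by (rule continuous_closedin_preimage_constant)
  moreover have "open ?Z"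
    unfolding open_dist
  proof
    fix r0 assume "r0 \<in> ?Z"
    then have "0 < r0" "u r0 = 0"
      by auto
    from zero_nbhd[OF nonneg this] obtain e where
      e: "0 < e" "e \<le> r0" "\<And>r. \<bar>r - r0\<bar> < e \<Longrightarrow> u r = 0"
      by metis
    then have "y \<in> ?Z" if "dist y r0 < e" for y
      using that by (auto simp: dist_real_def)
    with e(1) show "\<exists>e>0. \<forall>y. dist y r0 < e \<longrightarrow> y \<in> ?Z"
      by blast
  qed
  then have "openin (top_of_set {0<..}) ?Z"
    by (intro open_subset) auto
  ultimately have "?Z = {} \<or> ?Z = {0<..}"
    using connected_clopen[of "{0<..} :: real set"] connected_Ioi by blast
  then show ?thesis
  proof
    assume "?Z = {}"
    then have "0 < u r" if "0 < r" for r
      using that nonneg[OF that] by (auto simp: less_le)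
    then show ?thesis by blast
  next
    assume "?Z = {0<..}"
    then show ?thesis by blast
  qed
qed

end

section \<open>Smoothness\<close>

definition flux_slope :: "real \<Rightarrow> real \<Rightarrow> real \<Rightarrow> real" where
  "flux_slope p s c =
     p * ((s\<^sup>2 + c) powr (p / 2 - 1) + (p - 2) * (s\<^sup>2 + c) powr (p / 2 - 2) * s\<^sup>2)"

text \<open>This is the nondegeneracy: \<open>c > 0\<close> makes the base of the powers positive,
  so the first summand is positive, and \<open>p > 2\<close> makes the second non-negative.\<close>

lemma flux_slope_pos:
  assumes "2 < p" "0 < c" shows "0 < flux_slope p s c"
proof -
  have "0 < (s\<^sup>2 + c) powr (p / 2 - 1)"
    using assms by (simp add: add_nonneg_pos order_less_imp_not_eq2)
  then show ?thesis
    using assms unfolding flux_slope_def by (intro mult_pos_pos add_pos_nonneg) auto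
qed

lemma flux_DERIV_slope:
  assumes "0 < c"
  shows "((\<lambda>s. flux p s c) has_real_derivative flux_slope p s c) (at s)"
proof -
  have pos: "0 < s\<^sup>2 + c"
    using assms by (simp add: add_nonneg_pos)
  have "((\<lambda>s. s\<^sup>2 + c) has_real_derivative 2 * s) (at s)"
    by (auto intro!: derivative_eq_intros)
  from DERIV_mult[OF DERIV_cmult[OF DERIV_fun_powr[OF this pos], of p "p / 2 - 1"] DERIV_ident]
  show ?thesis
    unfolding flux_def flux_weight_def
    by (rule DERIV_cong) (simp add: flux_slope_def algebra_simps power2_eq_square)
qed

lemma flux_DERIV_snd:
  assumes "0 < c r" "(c has_real_derivative c') (at r)"
  shows "((\<lambda>r. flux p s (c r)) has_real_derivative
    p * (p / 2 - 1) * (s\<^sup>2 + c r) powr (p / 2 - 2) * c' * s) (at r)"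
proof -
  have pos: "0 < s\<^sup>2 + c r"
    using assms by (simp add: add_nonneg_pos)
  have "((\<lambda>r. s\<^sup>2 + c r) has_real_derivative c') (at r)"
    using DERIV_add[OF DERIV_const assms(2)] by simp
  from DERIV_cmult_right[OF DERIV_cmult[OF DERIV_fun_powr[OF this pos], of p "p / 2 - 1"], of s]
  show ?thesis
    unfolding flux_def flux_weight_def
    by (rule DERIV_cong) (simp add: algebra_simps)
qed

text \<open>The distance bound treats both orders of \<open>s\<close> and \<open>t\<close> alike and
  forces \<open>\<xi>\<close> to \<open>s\<close> as \<open>t\<close> tends to
  \<open>s\<close>.\<close>

lemma flux_mean_value:
  assumes "0 < c"
  obtains \<xi> where "\<bar>\<xi> - s\<bar> \<le> \<bar>t - s\<bar>" "flux p t c - flux p s c = flux_slope p \<xi> c * (t - s)"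
proof (cases s t rule: linorder_cases)
  case less
  then obtain \<xi> where \<xi>: "s < \<xi>" "\<xi> < t" "flux p t c - flux p s c = (t - s) * flux_slope p \<xi> c"
    using MVT2[OF less flux_DERIV_slope[OF assms]] by metis
  show ?thesis
    by (rule that[of \<xi>]) (use \<xi> in \<open>simp_all add: mult.commute\<close>)
next
  case equal
  then show ?thesis
    using that[of s] by simp
next
  case greater
  obtain \<xi> where \<xi>: "t < \<xi>" "\<xi> < s" "flux p s c - flux p t c = (s - t) * flux_slope p \<xi> c"
    using MVT2[OF greater flux_DERIV_slope[OF assms]] by metis
  have "flux p t c - flux p s c = - (flux p s c - flux p t c)"
    by simp
  also have "\<dots> = flux_slope p \<xi> c * (t - s)"
    unfolding \<xi>(3) by (simp add: left_diff_distrib right_diff_distrib mult.commute)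
  finally show ?thesis
    by (rule that[of \<xi>, rotated]) (use \<xi> in simp)
qed

text \<open>Only continuity of \<open>v\<close> at \<open>r\<close> is assumed. Subtracting
  \<open>flux p (v r) (c x)\<close>, which varies through \<open>c\<close> alone, isolates the
  dependence on the slope; the mean value theorem writes the rest as
  \<open>flux_slope p (\<xi> x) (c x) * (v x - v r)\<close>, and the first factor has a positive
  limit.\<close>

lemma implicit_flux_DERIV:
  assumes p: "2 < p" and c: "\<And>x. x \<in> S \<Longrightarrow> 0 < c x" "(c has_real_derivative c') (at r)"
    and S: "open S" "r \<in> S" and v: "(v \<longlongrightarrow> v r) (at r)"
    and a: "((\<lambda>x. flux p (v x) (c x)) has_real_derivative a') (at r)"
  shows "(v has_real_derivative
    (a' - p * (p / 2 - 1) * ((v r)\<^sup>2 + c r) powr (p / 2 - 2) * c' * v r) / flux_slope p (v r) (c r)) (at r)"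
    (is "(v has_real_derivative (a' - ?k') / _) (at r)")
proof -
  obtain \<xi> where \<xi>: "\<And>x. x \<in> S \<Longrightarrow> \<bar>\<xi> x - v r\<bar> \<le> \<bar>v x - v r\<bar>"
    "\<And>x. x \<in> S \<Longrightarrow> flux p (v x) (c x) - flux p (v r) (c x) = flux_slope p (\<xi> x) (c x) * (v x - v r)"
  proof -
    have "\<exists>\<xi>. x \<in> S \<longrightarrow> \<bar>\<xi> - v r\<bar> \<le> \<bar>v x - v r\<bar> \<and>
        flux p (v x) (c x) - flux p (v r) (c x) = flux_slope p \<xi> (c x) * (v x - v r)" for x
      using flux_mean_value[OF c(1), of x "v r" "v x"] by metis
    then show ?thesis
      using that by metis
  qed
  have ev: "\<forall>\<^sub>F x in at r. x \<in> S"
    using S by (rule eventually_at_in_open')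
  have "((\<lambda>x. \<bar>v x - v r\<bar>) \<longlongrightarrow> 0) (at r)"
    using tendsto_rabs[OF tendsto_diff[OF v tendsto_const[of "v r"]]] by simp
  moreover have "\<forall>\<^sub>F x in at r. norm (\<xi> x - v r) \<le> \<bar>v x - v r\<bar>"
    using ev by eventually_elim (simp add: \<xi>(1))
  ultimately have "((\<lambda>x. \<xi> x - v r) \<longlongrightarrow> 0) (at r)"
    by (rule Lim_null_comparison[rotated])
  then have \<xi>_lim: "(\<xi> \<longlongrightarrow> v r) (at r)"
    by (simp add: LIM_zero_iff)
  have c_lim: "(c \<longlongrightarrow> c r) (at r)"
    using DERIV_isCont[OF c(2)] by (simp add: isCont_def)
  have "(v r)\<^sup>2 + c r \<noteq> 0"
    using c(1)[OF S(2)] by (simp add: add_nonneg_pos order_less_imp_not_eq2)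
  then have slope: "((\<lambda>x. flux_slope p (\<xi> x) (c x)) \<longlongrightarrow> flux_slope p (v r) (c r)) (at r)"
    unfolding flux_slope_def by (intro tendsto_intros \<xi>_lim c_lim) simp_all
  have "((\<lambda>x. flux p (v x) (c x) - flux p (v r) (c x)) has_real_derivative a' - ?k') (at r)"
    using c S by (intro DERIV_diff a flux_DERIV_snd) auto
  \<comment> \<open>The differentiated function is 0 at \<open>x = r\<close>, so its difference
    quotient is its value divided by \<open>x - r\<close>.\<close>
  then have "((\<lambda>x. (flux p (v x) (c x) - flux p (v r) (c x)) / (x - r)) \<longlongrightarrow> a' - ?k') (at r)"
    by (simp add: has_field_derivative_iff)
  then have "((\<lambda>x. (flux p (v x) (c x) - flux p (v r) (c x)) / (x - r) / flux_slope p (\<xi> x) (c x))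
      \<longlongrightarrow> (a' - ?k') / flux_slope p (v r) (c r)) (at r)"
    using flux_slope_pos[OF p c(1)[OF S(2)]] by (intro tendsto_divide slope) (auto simp: less_imp_neq[symmetric])
  then have "((\<lambda>x. (v x - v r) / (x - r)) \<longlongrightarrow> (a' - ?k') / flux_slope p (v r) (c r)) (at r)"
  proof (rule Lim_transform_eventually)
    show "\<forall>\<^sub>F x in at r. (flux p (v x) (c x) - flux p (v r) (c x)) / (x - r) / flux_slope p (\<xi> x) (c x)
        = (v x - v r) / (x - r)"
      using ev
    proof eventually_elim
      case (elim x)
      have "flux_slope p (\<xi> x) (c x) \<noteq> 0"
        using flux_slope_pos[OF p c(1)[OF elim]] by (simp add: less_imp_neq[symmetric])
      then show ?case
        unfolding \<xi>(2)[OF elim] by simp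
    qed
  qed
  then show ?thesis
    by (simp add: has_field_derivative_iff)
qed

section \<open>Bootstrapping the classical equation\<close>

context radial_ode
begin

text \<open>The second derivative obtained by solving the differentiated flux identity. Apart from
  \<open>q\<close> and constants, quotients are written with \<open>inverse\<close>, so that the
  closure rules for \<open>ndiff\<close> match.\<close>

definition acceleration :: "real \<Rightarrow> real" where
  "acceleration r =
    (((flux_weight p (v r) (q r) * (u r * inverse r) - 2 * r * (1 - (u r)\<^sup>2) * u r) - flux p (v r) (q r))
        * inverse r
      - p * (p / 2 - 1) * ((v r)\<^sup>2 + q r) powr (p / 2 - 2)
        * (2 * u r * v r * (inverse r)\<^sup>2 - 2 * (u r)\<^sup>2 * inverse r ^ 3) * v r)
    * inverse (flux_slope p (v r) (q r))"

lemma v_DERIV: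
  assumes pos: "\<And>r. 0 < r \<Longrightarrow> 0 < u r" and r: "0 < r"
  shows "(v has_real_derivative acceleration r) (at r)"
proof -
  let ?B = "flux_weight p (v r) (q r) * (u r / r) - 2 * r * (1 - (u r)\<^sup>2) * u r"
  \<comment> \<open>The equation differentiates \<open>r * flux\<close>, so the flux itself is
    recovered by dividing by \<open>r\<close>.\<close>
  have "((\<lambda>x. x * flux p (v x) (q x) / x) has_real_derivative
      (?B * r - r * flux p (v r) (q r) * 1) / (r * r)) (at r)"
    using r by (intro DERIV_divide flux_DERIV DERIV_ident) auto
  then have "((\<lambda>x. flux p (v x) (q x)) has_real_derivative
      (?B * r - r * flux p (v r) (q r) * 1) / (r * r)) (at r)"
    by (rule has_field_derivative_transform_within_open[OF _ open_greaterThan[of 0]]) (use r in auto)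
  moreover have "(?B * r - r * flux p (v r) (q r) * 1) / (r * r) = (?B - flux p (v r) (q r)) * inverse r"
    using r by (simp add: field_simps)
  ultimately have a: "((\<lambda>x. flux p (v x) (q x)) has_real_derivative
      (?B - flux p (v r) (q r)) * inverse r) (at r)"
    by (rule DERIV_cong)
  have "((\<lambda>r. (u r)\<^sup>2) has_real_derivative 2 * u r * v r) (at r)"
    using DERIV_power[OF u_DERIV[OF r], of 2] by (simp add: mult_ac)
  moreover have "((\<lambda>r::real. r\<^sup>2) has_real_derivative 2 * r) (at r)"
    using DERIV_pow[of 2 r UNIV] by simp
  moreover have "r\<^sup>2 \<noteq> 0"
    using r by simp
  ultimately have "(q has_real_derivative (2 * u r * v r * r\<^sup>2 - (u r)\<^sup>2 * (2 * r)) / (r\<^sup>2 * r\<^sup>2)) (at r)"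
    by (rule DERIV_divide)
  moreover have "(2 * u r * v r * r\<^sup>2 - (u r)\<^sup>2 * (2 * r)) / (r\<^sup>2 * r\<^sup>2)
      = 2 * u r * v r * (inverse r)\<^sup>2 - 2 * (u r)\<^sup>2 * inverse r ^ 3"
  proof -
    have "inverse r * r = 1"
      using r by simp
    then show ?thesis
      unfolding divide_inverse inverse_mult_distrib power_inverse[symmetric] by algebra
  qed
  ultimately have c: "(q has_real_derivative
      2 * u r * v r * (inverse r)\<^sup>2 - 2 * (u r)\<^sup>2 * inverse r ^ 3) (at r)"
    by (rule DERIV_cong)
  have q_pos: "0 < q x" if "x \<in> {0<..}" for x
    using that by (intro divide_pos_pos zero_less_power pos) auto
  have "r \<in> {0<..}"
    using r by simp
  from implicit_flux_DERIV[OF p q_pos c open_greaterThan this v_lim[OF r] a]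
  show ?thesis
    unfolding acceleration_def divide_inverse[of "u r" r] by (simp only: divide_inverse[of _ "flux_slope p (v r) (q r)"])
qed

text \<open>\<open>v\<close> is the derivative of \<open>u\<close>, and the derivative of
  \<open>v\<close> is built from \<open>r\<close>, \<open>u\<close> and \<open>v\<close>, so each
  round gains one order for both. Positivity of \<open>u\<close> supplies the positive base and
  slope that \<open>ndiff_powr\<close> and \<open>ndiff_inverse\<close> demand.\<close>

lemma ndiff_solution:
  assumes pos: "\<And>r. 0 < r \<Longrightarrow> 0 < u r"
  shows "ndiff k {0<..} u \<and> ndiff k {0<..} v"
proof (induction k)
  case (Suc k)
  then have u: "ndiff k {0<..} u" and v: "ndiff k {0<..} v"
    by auto
  have i: "ndiff k {0<..} inverse"
    by (rule ndiff_inverse) auto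
  have c: "ndiff k {0<..} q"
    unfolding divide_inverse power_inverse[symmetric] by (intro ndiff_mult ndiff_power u i)
  have base: "0 < (v r)\<^sup>2 + q r" if "r \<in> {0<..}" for r
    using pos[of r] that by (simp add: add_nonneg_pos)
  have powr: "ndiff k {0<..} (\<lambda>r. ((v r)\<^sup>2 + q r) powr a)" for a
    by (intro ndiff_powr ndiff_add ndiff_power v c base)
  have slope: "ndiff k {0<..} (\<lambda>r. inverse (flux_slope p (v r) (q r)))"
  proof (rule ndiff_inverse[OF open_greaterThan])
    show "ndiff k {0<..} (\<lambda>r. flux_slope p (v r) (q r))"
      unfolding flux_slope_def by (intro ndiff_mult ndiff_add ndiff_power ndiff_const powr v)
    show "0 < flux_slope p (v r) (q r)" if "r \<in> {0<..}" for r
      using pos[of r] that by (intro flux_slope_pos p) simp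
  qed
  have "ndiff k {0<..} acceleration"
    unfolding acceleration_def[abs_def] flux_def flux_weight_def
    by (intro ndiff_mult ndiff_diff ndiff_power ndiff_const ndiff_id powr slope u v i)
  then have "ndiff (Suc k) {0<..} v"
    by (rule ndiff_SucI[rotated]) (use v_DERIV pos in auto)
  moreover have "ndiff (Suc k) {0<..} u"
    using v by (rule ndiff_SucI[rotated]) (use u_DERIV in auto)
  ultimately show ?case
    by blast
qed simp

end

section \<open>Sign and non-triviality of the continuous representative\<close>

context minimizing_pair
begin

text \<open>By continuity a negative value would persist on a non-empty open set, which is not a
  null set.\<close>

lemma F_nonneg:
  assumes "AE r in lebesgue. 0 < r \<longrightarrow> 0 \<le> F r" "0 < r"
  shows "0 \<le> F r"
proof (rule ccontr)
  assume "\<not> 0 \<le> F r"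
  let ?N = "{0<..} \<inter> F -` {..<0}"
  have "open ?N"
    using F_continuous by (rule continuous_open_preimage) auto
  moreover have "r \<in> ?N"
    using \<open>\<not> 0 \<le> F r\<close> assms(2) by simp
  moreover have "negligible ?N"
  proof (rule negligible_subset)
    show "negligible {r. \<not> (0 < r \<longrightarrow> 0 \<le> F r)}"
      using assms(1) by (simp add: negligible_iff_null_sets completion.AE_iff_null_sets)
  qed auto
  ultimately show False
    using open_not_negligible by blast
qed

text \<open>For \<open>F = 0\<close> the potential alone contributes \<open>r / 2\<close>, whose
  integral diverges; the slope term is non-negative and is dropped.\<close>

lemma F_not_zero: "\<not> (\<forall>r>0. F r = 0)"
proof
  assume zero: "\<forall>r>0. F r = 0"
  have "(\<infinity>::ennreal) = emeasure lebesgue {2::real..}"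
  proof -
    have "of_nat n \<le> emeasure lebesgue {2::real..}" for n
    proof -
      have "emeasure lebesgue {2..2 + real n} \<le> emeasure lebesgue {2::real..}"
        by (intro emeasure_mono) auto
      then show ?thesis
        by (simp add: ennreal_of_nat_eq_real_of_nat)
    qed
    then show ?thesis
      using ennreal_Ex_less_of_nat by (metis infinity_ennreal_def leD less_top)
  qed
  also have "\<dots> = (\<integral>\<^sup>+r. indicator {2::real..} r \<partial>lebesgue)"
    by (rule nn_integral_indicator[symmetric]) simp
  also have "\<dots> \<le> (\<integral>\<^sup>+r\<in>{0<..}. ennreal (energy_density p r (g r) (F r)) \<partial>lebesgue)"
  proof (rule nn_integral_mono)
    fix r :: real
    have "1 \<le> energy_density p r (g r) (F r)" if "2 \<le> r"
    proof -
      \<comment> \<open>The threshold 2 is where \<open>r / 2\<close> reaches 1.\<close>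
      have "1 / 2 * 2 \<le> ((g r)\<^sup>2 powr (p / 2) + 1 / 2) * r"
        using that by (intro mult_mono) auto
      then show ?thesis
        using zero that by (simp add: energy_density_def)
    qed
    then show "indicator {2..} r \<le> ennreal (energy_density p r (g r) (F r)) * indicator {0<..} r"
      by (auto split: split_indicator)
  qed
  also have "\<dots> = pair_energy p F g"
    unfolding pair_energy_def by (subst nn_integral_restrict_space) auto
  finally show False
    using finite_energy by (simp add: top_unique)
qed

end

theorem proposition2p3:
  fixes p :: real and f :: "real \<Rightarrow> real"
  assumes "p > 2"
    and "nonneg_minimizer p f"
  shows "\<exists>h. C_infinity_on {0<..} h \<and> (AE r in lebesgue. 0 < r \<longrightarrow> f r = h r)"
proof -
  obtain F g where F: "minimizing_pair p F g" and f_F: "AE r in lebesgue. 0 < r \<longrightarrow> f r = F r"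
    using nonneg_minimizer_pair assms by metis
  then interpret minimizing_pair p F g
    by simp
  have "AE r in lebesgue. 0 < r \<longrightarrow> 0 \<le> f r"
    using assms(2) by (simp add: nonneg_minimizer_def)
  with f_F have "AE r in lebesgue. 0 < r \<longrightarrow> 0 \<le> F r"
    by eventually_elim auto
  then have nonneg: "\<And>r. 0 < r \<Longrightarrow> 0 \<le> F r"
    using F_nonneg by blast
  obtain v where "radial_ode p F v"
    using radial_ode .
  then interpret ode: radial_ode p F v .
  have "\<And>r. 0 < r \<Longrightarrow> 0 < F r"
    using ode.positive_or_zero[OF nonneg] F_not_zero by blast
  then have "C_infinity_on {0<..} F"
    using ode.ndiff_solution by (simp add: C_infinity_on_iff_ndiff)
  with f_F show ?thesis
    by blast
qed

end
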